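(* For $n\ge 2$ let $\mathbf{P}_n=\{x_0=(x_{0,1},\ldots,x_{0,n})\in\mathbf{R}^n:\ \min_{1\le i\le n}x_{0,i}\ge 0,\ \sum_{i=1}^n x_{0,i}=1\}$. For $x_0\in\mathbf{P}_n$ let $(x_k)_{k\ge0}$ be the repeated averaging chain on $\mathbf{R}^n$ started from $x_0$ and let $T_{x_0}(k)=\sum_{i=1}^n|x_{k,i}-\tfrac1n|$. Let $\Phi$ be the cumulative distribution function of the standard normal distribution. Then for every $a\in\mathbf{R}$ and every $\epsilon>0$, as $n\to\infty$, \[ \sup_{x_0\in\mathbf{P}_n}\mathbb{P}\bigl[T_{x_0}(\lfloor n(\log_2(n)+a\sqrt{\log_2(n)})/2\rfloor)>2\Phi(-a)+\epsilon\bigr]\to 0. \]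
   Context: Repeated averaging chain on $\mathbf{R}^n$: given $x_k=(x_{k,1},\ldots,x_{k,n})$, pick a pair of distinct indices $I,J\in\{1,\ldots,n\}$ uniformly at random (independently of the past), replace both $x_{k,I}$ and $x_{k,J}$ by $(x_{k,I}+x_{k,J})/2$, and keep all other coordinates the same; the result is $x_{k+1}$. For fixed $a$ only $n$ large enough that the time index is nonnegative is considered. *)

theory Defs
  imports "HOL-Probability.Probability"
begin

text \<open>
  Points of \<open>\<real>\<^sup>n\<close>, for \<open>n\<close> varying, are functions on \<open>{1..n}\<close> that are \<open>undefined\<close> elsewhere.
\<close>

definition Rn :: "nat \<Rightarrow> (nat \<Rightarrow> real) set" where
  "Rn n = {1..n} \<rightarrow>\<^sub>E UNIV"

definition prob_vectors :: "nat \<Rightarrow> (nat \<Rightarrow> real) set" where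
  "prob_vectors n = {x \<in> Rn n. (\<forall>i\<in>{1..n}. 0 \<le> x i) \<and> (\<Sum>i=1..n. x i) = 1}"

definition average_pair :: "nat \<Rightarrow> nat \<Rightarrow> (nat \<Rightarrow> real) \<Rightarrow> nat \<Rightarrow> real" where
  "average_pair i j x = x(i := (x i + x j) / 2, j := (x i + x j) / 2)"

text \<open>
  The pair \<open>(I, J)\<close> is drawn uniformly from the ordered pairs of distinct indices.  This set is
  nonempty only for \<open>n \<ge> 2\<close>; smaller \<open>n\<close> carry no meaning here.
\<close>

definition averaging_kernel :: "nat \<Rightarrow> (nat \<Rightarrow> real) \<Rightarrow> (nat \<Rightarrow> real) pmf" where
  "averaging_kernel n x =
     map_pmf (\<lambda>(i, j). average_pair i j x)
       (pmf_of_set {(i, j). i \<in> {1..n} \<and> j \<in> {1..n} \<and> i \<noteq> j})"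

text \<open>
  The law of \<open>x\<^sub>k\<close> for the chain started from \<open>x0\<close>.  Drawing the next pair inside the bind makes it
  independent of the past.
\<close>

primrec averaging_chain :: "nat \<Rightarrow> (nat \<Rightarrow> real) \<Rightarrow> nat \<Rightarrow> (nat \<Rightarrow> real) pmf" where
  "averaging_chain n x0 0 = return_pmf x0"
| "averaging_chain n x0 (Suc k) = bind_pmf (averaging_chain n x0 k) (averaging_kernel n)"

definition L1_dev :: "nat \<Rightarrow> (nat \<Rightarrow> real) \<Rightarrow> real" where
  "L1_dev n x = (\<Sum>i=1..n. \<bar>x i - 1 / real n\<bar>)"

text \<open>For fixed \<open>a\<close> the floor is nonnegative for all large \<open>n\<close>, so \<open>nat\<close> truncates only finitely often.\<close>

definition cutoff_time :: "real \<Rightarrow> nat \<Rightarrow> nat" where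
  "cutoff_time a n = nat \<lfloor>real n * (log 2 (real n) + a * sqrt (log 2 (real n))) / 2\<rfloor>"

definition std_normal_cdf :: "real \<Rightarrow> real" where
  "std_normal_cdf = cdf std_normal_distribution"

end

theory Submission
  imports Defs "HOL-Real_Asymp.Real_Asymp"
begin

text \<open>
  Follow a unit of mass and count how often it has been halved: after \<open>k\<close> steps this count is
  binomial with parameters \<open>k\<close> and \<open>2/n\<close>.  Stop at \<open>K = t - r\<close>, where \<open>t\<close> is the cutoff time and
  \<open>r\<close> is about \<open>\<delta> n sqrt (log 2 n)\<close>, and weight mass halved \<open>m\<close> times by a ramp \<open>f m\<close> that falls from
  \<open>1\<close> to \<open>0\<close> below \<open>log 2 n\<close>, over a width \<open>\<delta> sqrt (log 2 n)\<close>.  The vector splits as \<open>y + z\<close>, with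
  \<open>z\<close> the mass weighted by \<open>f\<close>.  By the central limit theorem the total of \<open>z\<close> has expectation at
  most about \<open>\<Phi>(- a)\<close>; its variance tends to \<open>0\<close>, because the ramp has small slope and two portions
  of mass at distinct sites are not positively correlated.  The entries of \<open>y\<close> have been halved so often
  that its sum of squares is \<open>n powr (- 1 + o(1))\<close>, so the remaining \<open>r\<close> steps, each contracting
  the variance by \<open>1 - 1/n\<close> on average, flatten it in \<open>L\<^sup>1\<close>.  Finally \<open>z\<close> contributes at most twice its
  total.
\<close>

subsection \<open>Random lists of pairs\<close>

definition index_pairs :: "nat \<Rightarrow> (nat \<times> nat) set" where
  "index_pairs n = {(i, j). i \<in> {1..n} \<and> j \<in> {1..n} \<and> i \<noteq> j}"

lemma index_pairs_conv_Sigma: "index_pairs n = (SIGMA i:{1..n}. {1..n} - {i})"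
  by (auto simp: index_pairs_def)

lemma finite_index_pairs [simp]: "finite (index_pairs n)"
  by (simp add: index_pairs_conv_Sigma)

lemma card_index_pairs: "card (index_pairs n) = n * (n - 1)"
proof -
  have "card (index_pairs n) = (\<Sum>i\<in>{1..n}. card ({1..n} - {i}))"
    by (simp add: index_pairs_conv_Sigma card_SigmaI)
  also have "\<dots> = (\<Sum>i\<in>{1..n}. n - 1)"
    by (intro sum.cong) auto
  finally show ?thesis by simp
qed

lemma index_pairs_nonempty: "2 \<le> n \<Longrightarrow> index_pairs n \<noteq> {}"
  by (rule ex_in_conv[THEN iffD1], rule exI[of _ "(1, 2)"]) (simp add: index_pairs_def)

lemma sum_index_pairs_add:
  fixes d :: "nat \<Rightarrow> real"
  assumes "1 \<le> n"
  shows "(\<Sum>p\<in>index_pairs n. d (fst p) + d (snd p)) = 2 * (real n - 1) * (\<Sum>i=1..n. d i)"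
proof -
  have "(\<Sum>p\<in>index_pairs n. d (fst p) + d (snd p))
      = (\<Sum>i=1..n. \<Sum>j\<in>{1..n}-{i}. d i + d j)"
    by (simp add: index_pairs_conv_Sigma sum.Sigma case_prod_unfold)
  also have "\<dots> = (\<Sum>i=1..n. (real n - 1) * d i + ((\<Sum>j=1..n. d j) - d i))"
    using assms by (intro sum.cong) (auto simp: sum.distrib sum_diff1 of_nat_diff)
  also have "\<dots> = 2 * (real n - 1) * (\<Sum>i=1..n. d i)"
    by (simp only: sum.distrib sum_subtractf sum_distrib_left[symmetric])
       (use assms in \<open>simp add: algebra_simps\<close>)
  finally show ?thesis .
qed

lemma sum_index_pairs_mult:
  fixes d :: "nat \<Rightarrow> real"
  shows "(\<Sum>p\<in>index_pairs n. d (fst p) * d (snd p)) = (\<Sum>i=1..n. d i)\<^sup>2 - (\<Sum>i=1..n. (d i)\<^sup>2)"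
proof -
  have "(\<Sum>p\<in>index_pairs n. d (fst p) * d (snd p))
      = (\<Sum>i=1..n. \<Sum>j\<in>{1..n}-{i}. d i * d j)"
    by (simp add: index_pairs_conv_Sigma sum.Sigma case_prod_unfold)
  also have "\<dots> = (\<Sum>i=1..n. d i * (\<Sum>j=1..n. d j) - (d i)\<^sup>2)"
    by (intro sum.cong) (auto simp: sum_diff1 sum_distrib_left[symmetric] power2_eq_square algebra_simps)
  also have "\<dots> = (\<Sum>i=1..n. d i)\<^sup>2 - (\<Sum>i=1..n. (d i)\<^sup>2)"
    by (simp add: sum_subtractf sum_distrib_right[symmetric] power2_eq_square)
  finally show ?thesis .
qed

text \<open>Every one-step change below is a constant, plus a term additive over the two drawn
  sites, plus a product term; this turns each one-step expectation into sums over sites.\<close>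

lemma expectation_pmf_of_index_pairs:
  fixes u v :: "nat \<Rightarrow> real"
  assumes "2 \<le> n"
    and "\<And>i j. (i, j) \<in> index_pairs n \<Longrightarrow> F (i, j) = c + (u i + u j) + b * (v i * v j)"
  shows "measure_pmf.expectation (pmf_of_set (index_pairs n)) F
    = c + 2 / n * (\<Sum>i=1..n. u i) + b / (n * (real n - 1)) * ((\<Sum>i=1..n. v i)\<^sup>2 - (\<Sum>i=1..n. (v i)\<^sup>2))"
proof -
  have c: "real (card (index_pairs n)) = n * (real n - 1)"
    using assms(1) by (simp add: card_index_pairs of_nat_diff)
  have "(\<Sum>p\<in>index_pairs n. F p)
      = (\<Sum>p\<in>index_pairs n. c + (u (fst p) + u (snd p)) + b * (v (fst p) * v (snd p)))"
    using assms(2) by (intro sum.cong) auto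
  also have "\<dots> = n * (real n - 1) * c + 2 * (real n - 1) * (\<Sum>i=1..n. u i)
      + b * ((\<Sum>i=1..n. v i)\<^sup>2 - (\<Sum>i=1..n. (v i)\<^sup>2))"
    using sum_index_pairs_add[of n u] sum_index_pairs_mult[of v n] assms(1)
    by (simp add: sum.distrib sum_distrib_left[symmetric] c)
  finally have *: "measure_pmf.expectation (pmf_of_set (index_pairs n)) F
      = (n * (real n - 1) * c + 2 * (real n - 1) * (\<Sum>i=1..n. u i)
        + b * ((\<Sum>i=1..n. v i)\<^sup>2 - (\<Sum>i=1..n. (v i)\<^sup>2))) / (n * (real n - 1))"
    using index_pairs_nonempty[OF assms(1)] by (simp add: integral_pmf_of_set c)
  have "real n \<noteq> 0" "real n - 1 \<noteq> 0" using assms(1) by auto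
  then show ?thesis
    unfolding * by (simp add: divide_simps) (simp add: algebra_simps)
qed

text \<open>The randomness is kept apart from the state: one list of pairs drives
  \<open>weighted_mass\<close> for every weight at once, so masses with different weights can be
  compared path by path. The newest pair is the head.\<close>

primrec pair_lists :: "nat \<Rightarrow> nat \<Rightarrow> (nat \<times> nat) list pmf" where
  "pair_lists n 0 = return_pmf []"
| "pair_lists n (Suc k) =
     bind_pmf (pair_lists n k) (\<lambda>ps. map_pmf (\<lambda>p. p # ps) (pmf_of_set (index_pairs n)))"

lemma set_pair_lists: "2 \<le> n \<Longrightarrow> ps \<in> set_pmf (pair_lists n k) \<Longrightarrow> set ps \<subseteq> index_pairs n"
proof (induction k arbitrary: ps)
  case (Suc k)
  then obtain p qs where "ps = p # qs" "p \<in> index_pairs n" "qs \<in> set_pmf (pair_lists n k)"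
    using index_pairs_nonempty[of n] by (auto simp: set_pmf_of_set)
  then show ?case using Suc by auto
qed simp

lemma finite_pair_lists [simp]: "2 \<le> n \<Longrightarrow> finite (set_pmf (pair_lists n k))"
  by (induction k) (simp_all add: index_pairs_nonempty set_pmf_of_set)

lemma integrable_pair_lists [simp]:
  fixes F :: "(nat \<times> nat) list \<Rightarrow> real"
  shows "2 \<le> n \<Longrightarrow> integrable (measure_pmf (pair_lists n k)) F"
  by (simp add: integrable_measure_pmf_finite)

text \<open>Conditions on all pairs but the newest; all supports are finite.\<close>

lemma expectation_pair_lists_Suc:
  fixes F :: "(nat \<times> nat) list \<Rightarrow> real"
  assumes n: "2 \<le> n"
  shows "measure_pmf.expectation (pair_lists n (Suc k)) F
    = measure_pmf.expectation (pair_lists n k)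
        (\<lambda>ps. measure_pmf.expectation (pmf_of_set (index_pairs n)) (\<lambda>p. F (p # ps)))"
proof -
  let ?A = "set_pmf (pair_lists n k)"
  show ?thesis
    unfolding pair_lists.simps
    using n index_pairs_nonempty[OF n]
    by (subst pmf_expectation_bind[of ?A])
       (auto simp: set_pmf_of_set integral_measure_pmf[where A = ?A])
qed

lemma expectation_pair_lists_mono:
  fixes F G :: "(nat \<times> nat) list \<Rightarrow> real"
  assumes "2 \<le> n" "\<And>ps. set ps \<subseteq> index_pairs n \<Longrightarrow> F ps \<le> G ps"
  shows "measure_pmf.expectation (pair_lists n k) F \<le> measure_pmf.expectation (pair_lists n k) G"
  using assms set_pair_lists[OF assms(1)]
  by (intro integral_mono_AE) (auto simp: AE_measure_pmf_iff)

subsection \<open>Mass weighted by its number of halvings\<close>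

text \<open>
  The mass arriving at each site, a portion that has been halved \<open>m\<close> times counting with weight
  \<open>f m\<close>.  The most recent pair is the head of the list.
\<close>

primrec weighted_mass ::
    "(nat \<Rightarrow> real) \<Rightarrow> (nat \<times> nat) list \<Rightarrow> (nat \<Rightarrow> real) \<Rightarrow> nat \<Rightarrow> real" where
  "weighted_mass x [] f = (\<lambda>l. x l * f 0)"
| "weighted_mass x (p # ps) f = (\<lambda>l.
     if l = fst p \<or> l = snd p
     then (weighted_mass x ps (\<lambda>m. f (Suc m)) (fst p) + weighted_mass x ps (\<lambda>m. f (Suc m)) (snd p)) / 2
     else weighted_mass x ps f l)"

text \<open>\<open>foldr\<close> makes the head of the list act last, in agreement with
  \<open>pair_lists\<close>.\<close>

definition average_pairs :: "(nat \<times> nat) list \<Rightarrow> (nat \<Rightarrow> real) \<Rightarrow> nat \<Rightarrow> real" where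
  "average_pairs = foldr (\<lambda>(i, j). average_pair i j)"

lemma average_pairs_simps [simp]:
  "average_pairs [] x = x"
  "average_pairs (p # ps) x = average_pair (fst p) (snd p) (average_pairs ps x)"
  by (simp_all add: average_pairs_def case_prod_unfold)

lemma averaging_chain_conv_pair_lists:
  "averaging_chain n x k = map_pmf (\<lambda>ps. average_pairs ps x) (pair_lists n k)"
proof (induction k)
  case (Suc k)
  then show ?case
    by (simp add: map_bind_pmf bind_map_pmf averaging_kernel_def[abs_def] index_pairs_def
        pmf.map_comp o_def case_prod_unfold)
qed simp

text \<open>With unit weight nothing is discounted, so splitting the weight 1 into
  \<open>1 - f\<close> and \<open>f\<close> splits the chain itself.\<close>

lemma weighted_mass_const: "weighted_mass x ps (\<lambda>_. 1) l = average_pairs ps x l"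
  by (induction ps arbitrary: l) (auto simp: average_pair_def)

section \<open>Linearity and monotonicity in the weight\<close>

lemma weighted_mass_lincomb:
  "weighted_mass x ps (\<lambda>m. a * f m + b * g m) l = a * weighted_mass x ps f l + b * weighted_mass x ps g l"
proof (induction ps arbitrary: f g l)
  case (Cons p ps)
  show ?case by (simp only: weighted_mass.simps Cons.IH) (simp add: field_simps)
qed (simp add: algebra_simps)

lemma weighted_mass_add:
  "weighted_mass x ps (\<lambda>m. f m + g m) l = weighted_mass x ps f l + weighted_mass x ps g l"
  using weighted_mass_lincomb[of x ps 1 f 1 g] by simp

lemma weighted_mass_diff:
  "weighted_mass x ps (\<lambda>m. f m - g m) l = weighted_mass x ps f l - weighted_mass x ps g l"
  using weighted_mass_lincomb[of x ps 1 f "-1" g] by simp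

lemma weighted_mass_cmult:
  "weighted_mass x ps (\<lambda>m. a * f m) l = a * weighted_mass x ps f l"
  using weighted_mass_lincomb[of x ps a f 0 f] by simp

lemma weighted_mass_mono:
  assumes "set ps \<subseteq> index_pairs n" "\<And>i. i \<in> {1..n} \<Longrightarrow> 0 \<le> x i" "\<And>m. f m \<le> g m" "l \<in> {1..n}"
  shows "weighted_mass x ps f l \<le> weighted_mass x ps g l"
  using assms(1,3,4)
proof (induction ps arbitrary: f g l)
  case Nil
  then show ?case using assms(2) by (simp add: mult_left_mono)
next
  case (Cons p ps)
  have p: "fst p \<in> {1..n}" "snd p \<in> {1..n}" and ps: "set ps \<subseteq> index_pairs n"
    using Cons.prems(1) by (auto simp: index_pairs_def)
  then show ?case
    using Cons.IH[OF ps Cons.prems(2) Cons.prems(3)]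
      Cons.IH[OF ps, of "\<lambda>m. f (Suc m)" "\<lambda>m. g (Suc m)"] Cons.prems(2)
    by (auto simp del: atLeastAtMost_iff intro!: add_mono divide_right_mono)
qed

lemma weighted_mass_nonneg:
  fixes f :: "nat \<Rightarrow> real"
  assumes "set ps \<subseteq> index_pairs n" "\<And>i. i \<in> {1..n} \<Longrightarrow> 0 \<le> x i" "\<And>m. 0 \<le> f m" "l \<in> {1..n}"
  shows "0 \<le> weighted_mass x ps f l"
proof -
  have "weighted_mass x ps (\<lambda>m. 0 * f m) l \<le> weighted_mass x ps f l"
    by (rule weighted_mass_mono) (use assms in auto)
  then show ?thesis unfolding weighted_mass_cmult by simp
qed

text \<open>A draw alters only the entries \<open>i\<close> and \<open>j\<close>. Used alike for
  total masses, sums of squares and sums of absolute values.\<close>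

lemma sum_replace_pair:
  fixes v :: "nat \<Rightarrow> real"
  assumes "(i, j) \<in> index_pairs n"
  shows "(\<Sum>l=1..n. if l = i \<or> l = j then a else v l) = (\<Sum>l=1..n. v l) - v i - v j + 2 * a"
proof -
  have *: "i \<in> {1..n}" "j \<in> {1..n} - {i}" using assms by (auto simp: index_pairs_def)
  let ?R = "{1..n} - {i} - {j}"
  have split: "(\<Sum>l=1..n. g l) = g i + (g j + (\<Sum>l\<in>?R. g l))" for g :: "nat \<Rightarrow> real"
    using sum.remove[of "{1..n}" i g] sum.remove[of "{1..n} - {i}" j g] * by simp
  have "(\<Sum>l\<in>?R. if l = i \<or> l = j then a else v l) = (\<Sum>l\<in>?R. v l)"
    by (intro sum.cong) auto
  then show ?thesis
    by (simp only: split[of v] split[of "\<lambda>l. if l = i \<or> l = j then a else v l"]) simp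
qed

section \<open>First moment of the total weighted mass\<close>

text \<open>The transition operator of the halving count of a tagged unit of mass: wherever it sits,
  its site is drawn with probability 2/n.\<close>

definition touch_step :: "nat \<Rightarrow> (nat \<Rightarrow> real) \<Rightarrow> nat \<Rightarrow> real" where
  "touch_step n f = (\<lambda>m. (1 - 2 / n) * f m + 2 / n * f (Suc m))"

lemma weighted_mass_touch_step:
  "weighted_mass x ps (touch_step n f) l
    = weighted_mass x ps f l + 2 / n * weighted_mass x ps (\<lambda>m. f (Suc m) - f m) l"
  unfolding touch_step_def weighted_mass_lincomb weighted_mass_diff by (simp add: algebra_simps)

text \<open>Averaging conserves mass, so the total changes only because the mass at the two drawn
  sites passes from weight \<open>f m\<close> to \<open>f (Suc m)\<close>.\<close>

lemma sum_weighted_mass_Cons: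
  assumes "(i, j) \<in> index_pairs n"
  shows "(\<Sum>l=1..n. weighted_mass x ((i, j) # ps) f l) = (\<Sum>l=1..n. weighted_mass x ps f l)
    + (weighted_mass x ps (\<lambda>m. f (Suc m) - f m) i + weighted_mass x ps (\<lambda>m. f (Suc m) - f m) j)"
  unfolding weighted_mass.simps fst_conv snd_conv sum_replace_pair[OF assms] weighted_mass_diff by simp

lemma expectation_sum_weighted_mass_Cons:
  assumes "2 \<le> n"
  shows "measure_pmf.expectation (pmf_of_set (index_pairs n)) (\<lambda>p. \<Sum>l=1..n. weighted_mass x (p # ps) f l)
    = (\<Sum>l=1..n. weighted_mass x ps (touch_step n f) l)"
proof -
  let ?d = "weighted_mass x ps (\<lambda>m. f (Suc m) - f m)" and ?s = "\<Sum>l=1..n. weighted_mass x ps f l"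
  have "(\<Sum>l=1..n. weighted_mass x ((i, j) # ps) f l) = ?s + (?d i + ?d j) + 0 * (0 * 0)"
    if "(i, j) \<in> index_pairs n" for i j
    unfolding sum_weighted_mass_Cons[OF that] by simp
  from expectation_pmf_of_index_pairs[OF assms, of _ ?s ?d 0 "\<lambda>_. 0", OF this] show ?thesis
    by (simp add: weighted_mass_touch_step sum.distrib sum_distrib_left del: weighted_mass.simps)
qed

text \<open>Averaging over the newest pair replaces \<open>f\<close> by
  \<open>touch_step n f\<close>, so the induction peels off the newest pairs while the weight
  varies. Only the total of \<open>x\<close> survives, since the law of the halving count does not
  depend on where the mass sits.\<close>

lemma expectation_sum_weighted_mass:
  assumes "2 \<le> n"
  shows "measure_pmf.expectation (pair_lists n k) (\<lambda>ps. \<Sum>l=1..n. weighted_mass x ps f l)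
    = (touch_step n ^^ k) f 0 * (\<Sum>l=1..n. x l)"
proof (induction k arbitrary: f)
  case 0
  then show ?case by (simp add: sum_distrib_right[symmetric])
next
  case (Suc k)
  then show ?case
    unfolding expectation_pair_lists_Suc[OF assms] expectation_sum_weighted_mass_Cons[OF assms]
    by (simp only: funpow_Suc_right o_apply)
qed

lemma sum_average_pairs:
  assumes "set ps \<subseteq> index_pairs n"
  shows "(\<Sum>l=1..n. average_pairs ps x l) = (\<Sum>l=1..n. x l)"
  using assms
proof (induction ps)
  case (Cons p ps)
  then show ?case
    using sum_weighted_mass_Cons[of "fst p" "snd p" n x ps "\<lambda>_. 1"] weighted_mass_cmult[of x ps 0 "\<lambda>_. 0"]
    by (simp add: weighted_mass_const del: weighted_mass.simps average_pairs_simps)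
qed simp

section \<open>Second moments of weighted masses\<close>

text \<open>The increment is \<open>d i + d j\<close>, with \<open>d\<close> the change of weighted
  mass at a site when it is touched. Its mean is absorbed by the first square on the right; distinct
  sites are not positively correlated, so only the squares of \<open>d\<close> remain as
  variance.\<close>

lemma expectation_square_sum_weighted_mass_Cons:
  assumes "2 \<le> n"
  shows "measure_pmf.expectation (pmf_of_set (index_pairs n)) (\<lambda>p. (\<Sum>l=1..n. weighted_mass x (p # ps) f l)\<^sup>2)
    \<le> (\<Sum>l=1..n. weighted_mass x ps (touch_step n f) l)\<^sup>2
      + 2 / n * (\<Sum>l=1..n. (weighted_mass x ps (\<lambda>m. f (Suc m) - f m) l)\<^sup>2)"
proof -
  define s where "s = (\<Sum>l=1..n. weighted_mass x ps f l)"
  define d where "d = weighted_mass x ps (\<lambda>m. f (Suc m) - f m)"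
  define D where "D = (\<Sum>l=1..n. d l)"
  define D2 where "D2 = (\<Sum>l=1..n. (d l)\<^sup>2)"
  have n: "real n \<ge> 2" using assms by simp
  have "measure_pmf.expectation (pmf_of_set (index_pairs n)) (\<lambda>p. (\<Sum>l=1..n. weighted_mass x (p # ps) f l)\<^sup>2)
    = s\<^sup>2 + 2 / n * (\<Sum>l=1..n. 2 * s * d l + (d l)\<^sup>2) + 2 / (n * (real n - 1)) * (D\<^sup>2 - D2)"
    unfolding D_def D2_def
  proof (rule expectation_pmf_of_index_pairs[OF assms])
    fix i j assume "(i, j) \<in> index_pairs n"
    from sum_weighted_mass_Cons[OF this, of x ps f]
    have "(\<Sum>l=1..n. weighted_mass x ((i, j) # ps) f l) = s + (d i + d j)"
      by (simp only: s_def d_def)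
    then show "(\<Sum>l=1..n. weighted_mass x ((i, j) # ps) f l)\<^sup>2
      = s\<^sup>2 + (2 * s * d i + (d i)\<^sup>2 + (2 * s * d j + (d j)\<^sup>2)) + 2 * (d i * d j)"
      by (simp only:) (simp add: power2_eq_square algebra_simps)
  qed
  also have "(\<Sum>l=1..n. 2 * s * d l + (d l)\<^sup>2) = 2 * s * D + D2"
    by (simp add: sum.distrib sum_distrib_left D_def D2_def)
  also have "s\<^sup>2 + 2 / n * (2 * s * D + D2) + 2 / (n * (real n - 1)) * (D\<^sup>2 - D2)
    \<le> (s + 2 / n * D)\<^sup>2 + 2 / n * D2"
  proof -
    \<comment> \<open>Two given distinct sites are both drawn with probability 2/(n (n - 1)), which
      is at most (2/n)^2 when n >= 2.\<close>
    have "2 / (n * (real n - 1)) \<le> 4 / (real n)\<^sup>2"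
      using n by (simp add: power2_eq_square divide_simps) 
    then have 1: "2 / (n * (real n - 1)) * D\<^sup>2 \<le> 4 / (real n)\<^sup>2 * D\<^sup>2"
      by (intro mult_right_mono) auto
    have "0 \<le> D2" by (simp add: D2_def sum_nonneg)
    then have 2: "0 \<le> 2 / (n * (real n - 1)) * D2" using n by simp
    have "(s + 2 / n * D)\<^sup>2 = s\<^sup>2 + 2 / n * (2 * s * D) + 4 / (real n)\<^sup>2 * D\<^sup>2"
      using n by (simp add: power2_eq_square field_simps)
    moreover have "2 / n * (2 * s * D + D2) = 2 / n * (2 * s * D) + 2 / n * D2"
      "2 / (n * (real n - 1)) * (D\<^sup>2 - D2) = 2 / (n * (real n - 1)) * D\<^sup>2 - 2 / (n * (real n - 1)) * D2"
      by (simp_all only: distrib_left right_diff_distrib)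
    ultimately show ?thesis using 1 2 by linarith
  qed
  also have "s + 2 / n * D = (\<Sum>l=1..n. weighted_mass x ps (touch_step n f) l)"
    by (simp add: weighted_mass_touch_step sum.distrib sum_distrib_left s_def D_def d_def)
  finally show ?thesis by (simp add: D2_def d_def)
qed

text \<open>The two new equal entries contribute twice the square of their mean, so a drawn site
  keeps half its square, now under the shifted weight \<open>h\<close>, and the cross terms are
  spread over all pairs. Constant \<open>g\<close> gives the contraction of the chain; a
  \<open>g\<close> suppressing lightly halved mass controls the heavily halved part.\<close>

lemma expectation_sum_weighted_mass_square_Cons:
  fixes g :: "nat \<Rightarrow> real"
  assumes "2 \<le> n"
  defines "h \<equiv> \<lambda>m. g (Suc m)"
  shows "measure_pmf.expectation (pmf_of_set (index_pairs n)) (\<lambda>p. \<Sum>l=1..n. (weighted_mass x (p # ps) g l)\<^sup>2)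
    \<le> (1 - 2 / n) * (\<Sum>l=1..n. (weighted_mass x ps g l)\<^sup>2)
      + 1 / n * (\<Sum>l=1..n. (weighted_mass x ps h l)\<^sup>2)
      + 1 / (n * (real n - 1)) * (\<Sum>l=1..n. weighted_mass x ps h l)\<^sup>2"
proof -
  let ?g = "weighted_mass x ps g" and ?h = "weighted_mass x ps h"
  have *: "(\<Sum>l=1..n. (weighted_mass x ((i, j) # ps) g l)\<^sup>2)
      = (\<Sum>l=1..n. (?g l)\<^sup>2) + ((- (?g i)\<^sup>2 + (?h i)\<^sup>2 / 2) + (- (?g j)\<^sup>2 + (?h j)\<^sup>2 / 2)) + 1 * (?h i * ?h j)"
    if "(i, j) \<in> index_pairs n" for i j
  proof -
    have "(\<Sum>l=1..n. (weighted_mass x ((i, j) # ps) g l)\<^sup>2)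
       = (\<Sum>l=1..n. if l = i \<or> l = j then ((?h i + ?h j) / 2)\<^sup>2 else (?g l)\<^sup>2)"
      by (intro sum.cong) (auto simp: h_def)
    then show ?thesis
      unfolding sum_replace_pair[OF that] by (simp add: power2_eq_square field_simps)
  qed
  have "measure_pmf.expectation (pmf_of_set (index_pairs n)) (\<lambda>p. \<Sum>l=1..n. (weighted_mass x (p # ps) g l)\<^sup>2)
    = (\<Sum>l=1..n. (?g l)\<^sup>2) + 2 / n * (\<Sum>l=1..n. - (?g l)\<^sup>2 + (?h l)\<^sup>2 / 2)
      + 1 / (n * (real n - 1)) * ((\<Sum>l=1..n. ?h l)\<^sup>2 - (\<Sum>l=1..n. (?h l)\<^sup>2))"
    by (rule expectation_pmf_of_index_pairs[OF assms(1)], rule *)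
  also have "(\<Sum>l=1..n. - (?g l)\<^sup>2 + (?h l)\<^sup>2 / 2) = - (\<Sum>l=1..n. (?g l)\<^sup>2) + (\<Sum>l=1..n. (?h l)\<^sup>2) / 2"
    by (simp add: sum.distrib sum_subtractf sum_negf sum_divide_distrib)
  finally have eq: "measure_pmf.expectation (pmf_of_set (index_pairs n)) (\<lambda>p. \<Sum>l=1..n. (weighted_mass x (p # ps) g l)\<^sup>2)
    = (\<Sum>l=1..n. (?g l)\<^sup>2) + 2 / n * (- (\<Sum>l=1..n. (?g l)\<^sup>2) + (\<Sum>l=1..n. (?h l)\<^sup>2) / 2)
      + 1 / (n * (real n - 1)) * ((\<Sum>l=1..n. ?h l)\<^sup>2 - (\<Sum>l=1..n. (?h l)\<^sup>2))" .
  have "1 / (n * (real n - 1)) * ((\<Sum>l=1..n. ?h l)\<^sup>2 - (\<Sum>l=1..n. (?h l)\<^sup>2))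
      \<le> 1 / (n * (real n - 1)) * (\<Sum>l=1..n. ?h l)\<^sup>2"
    using assms(1) by (intro mult_left_mono) (auto simp: sum_nonneg)
  then show ?thesis
    unfolding eq by (simp add: algebra_simps)
qed

text \<open>Iteration of q -> (1 - 1/n) q + S^2/(n (n - 1)), with S the total of \<open>x\<close>;
  its fixed point is S^2/(n - 1). For total 0 it is a pure contraction.\<close>

lemma expectation_sum_squares:
  assumes n: "2 \<le> n"
  shows "measure_pmf.expectation (pair_lists n k) (\<lambda>ps. \<Sum>l=1..n. (average_pairs ps x l)\<^sup>2)
    \<le> (1 - 1 / n) ^ k * (\<Sum>l=1..n. (x l)\<^sup>2) + (\<Sum>l=1..n. x l)\<^sup>2 / (real n - 1)"
proof (induction k)
  case 0
  show ?case using n by simp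
next
  case (Suc k)
  let ?E = "measure_pmf.expectation (pair_lists n k)"
  let ?S = "\<Sum>l=1..n. x l"
  have n': "real n \<ge> 2" using n by simp
  have "measure_pmf.expectation (pair_lists n (Suc k)) (\<lambda>ps. \<Sum>l=1..n. (average_pairs ps x l)\<^sup>2)
    \<le> ?E (\<lambda>ps. (1 - 1 / n) * (\<Sum>l=1..n. (average_pairs ps x l)\<^sup>2) + 1 / (n * (real n - 1)) * ?S\<^sup>2)"
    unfolding expectation_pair_lists_Suc[OF n]
  proof (intro expectation_pair_lists_mono[OF n])
    fix ps assume "set ps \<subseteq> index_pairs n"
    then show "measure_pmf.expectation (pmf_of_set (index_pairs n)) (\<lambda>p. \<Sum>l=1..n. (average_pairs (p # ps) x l)\<^sup>2)
      \<le> (1 - 1 / n) * (\<Sum>l=1..n. (average_pairs ps x l)\<^sup>2) + 1 / (n * (real n - 1)) * ?S\<^sup>2"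
      using expectation_sum_weighted_mass_square_Cons[OF n, of x ps "\<lambda>_. 1"]
      unfolding weighted_mass_const sum_average_pairs[OF \<open>set ps \<subseteq> index_pairs n\<close>]
      by (simp add: algebra_simps diff_divide_distrib)
  qed
  also have "\<dots> = (1 - 1 / n) * ?E (\<lambda>ps. (\<Sum>l=1..n. (average_pairs ps x l)\<^sup>2)) + 1 / (n * (real n - 1)) * ?S\<^sup>2"
    using n by (simp del: sum.cong)
  also have "\<dots> \<le> (1 - 1 / n) * ((1 - 1 / n) ^ k * (\<Sum>l=1..n. (x l)\<^sup>2) + ?S\<^sup>2 / (real n - 1)) + 1 / (n * (real n - 1)) * ?S\<^sup>2"
    using Suc n' by (intro add_right_mono mult_left_mono) (auto simp: field_simps)
  also have "\<dots> = (1 - 1 / n) ^ Suc k * (\<Sum>l=1..n. (x l)\<^sup>2) + ?S\<^sup>2 / (real n - 1)"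
  proof -
    have "(1 - 1 / n) * (?S\<^sup>2 / (real n - 1)) + 1 / (n * (real n - 1)) * ?S\<^sup>2 = ?S\<^sup>2 / (real n - 1)"
      using n' by (simp add: divide_simps) (simp add: algebra_simps)
    then show ?thesis by (simp add: distrib_left)
  qed
  finally show ?case .
qed

lemma sum_squares_le_square_sum:
  fixes x :: "'a \<Rightarrow> real"
  assumes "finite A" "\<And>i. i \<in> A \<Longrightarrow> 0 \<le> x i"
  shows "(\<Sum>i\<in>A. (x i)\<^sup>2) \<le> (\<Sum>i\<in>A. x i)\<^sup>2"
proof -
  have "x i * x i \<le> x i * (\<Sum>i\<in>A. x i)" if "i \<in> A" for i
    using assms that by (intro mult_left_mono member_le_sum) auto
  then have "(\<Sum>i\<in>A. x i * x i) \<le> (\<Sum>i\<in>A. x i * (\<Sum>i\<in>A. x i))"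
    by (rule sum_mono)
  then show ?thesis
    by (simp add: power2_eq_square sum_distrib_right)
qed

text \<open>The bound is stationary, hence uniform in \<open>k\<close>: shifting \<open>g\<close> by
  one halving doubles \<open>c\<close>, and (1 - 2/n) c + (1/n) 2c = c, while the cross terms
  reproduce 1/(n - 1). The growth allowed to \<open>g\<close> reflects that a portion halved
  \<open>m\<close> times has shrunk by the factor \<open>2 ^ m\<close>.\<close>

lemma expectation_weighted_mass_squares_le:
  assumes n: "2 \<le> n" and x: "\<And>i. i \<in> {1..n} \<Longrightarrow> 0 \<le> x i" "(\<Sum>l=1..n. x l) = 1"
    and g: "\<And>m. 0 \<le> g m" "\<And>m. g m \<le> 1" "\<And>m. (g m)\<^sup>2 \<le> c * 2 ^ m"
  shows "measure_pmf.expectation (pair_lists n k) (\<lambda>ps. \<Sum>l=1..n. (weighted_mass x ps g l)\<^sup>2)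
    \<le> c + 1 / (real n - 1)"
  using g
proof (induction k arbitrary: g c)
  case 0
  have "(\<Sum>l=1..n. (x l)\<^sup>2) \<le> (\<Sum>l=1..n. x l)\<^sup>2"
    using x(1) by (intro sum_squares_le_square_sum) auto
  then have "(\<Sum>l=1..n. (x l)\<^sup>2) * (g 0)\<^sup>2 \<le> 1 * c"
    using "0.prems"(3)[of 0] x by (intro mult_mono) auto
  moreover have "0 \<le> 1 / (real n - 1)" using n by simp
  ultimately have "(\<Sum>l=1..n. (x l)\<^sup>2) * (g 0)\<^sup>2 \<le> c + 1 / (real n - 1)"
    by linarith
  then show ?case by (simp add: power_mult_distrib sum_distrib_right[symmetric])
next
  case (Suc k)
  let ?E = "measure_pmf.expectation (pair_lists n k)"
  let ?h = "\<lambda>m. g (Suc m)"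
  have n': "real n \<ge> 2" using n by simp
  have "measure_pmf.expectation (pair_lists n (Suc k)) (\<lambda>ps. \<Sum>l=1..n. (weighted_mass x ps g l)\<^sup>2)
    \<le> ?E (\<lambda>ps. (1 - 2 / n) * (\<Sum>l=1..n. (weighted_mass x ps g l)\<^sup>2)
        + 1 / n * (\<Sum>l=1..n. (weighted_mass x ps ?h l)\<^sup>2) + 1 / (n * (real n - 1)))"
    unfolding expectation_pair_lists_Suc[OF n]
  proof (rule expectation_pair_lists_mono[OF n])
    fix ps assume ps: "set ps \<subseteq> index_pairs n"
    have nn: "0 \<le> weighted_mass x ps ?h l" if "l \<in> {1..n}" for l
      by (rule weighted_mass_nonneg) (use ps x that Suc.prems in auto)
    have "weighted_mass x ps ?h l \<le> weighted_mass x ps (\<lambda>_. 1) l" if "l \<in> {1..n}" for l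
      by (rule weighted_mass_mono) (use ps x that Suc.prems in auto)
    then have "(\<Sum>l=1..n. weighted_mass x ps ?h l) \<le> (\<Sum>l=1..n. average_pairs ps x l)"
      unfolding weighted_mass_const by (rule sum_mono)
    then have "(\<Sum>l=1..n. weighted_mass x ps ?h l) \<le> 1"
      using sum_average_pairs[OF ps, of x] x by simp
    then have "(\<Sum>l=1..n. weighted_mass x ps ?h l)\<^sup>2 \<le> 1"
      by (intro power_le_one sum_nonneg nn)
    then have "1 / (n * (real n - 1)) * (\<Sum>l=1..n. weighted_mass x ps ?h l)\<^sup>2 \<le> 1 / (n * (real n - 1)) * 1"
      using n' by (intro mult_left_mono) auto
    with expectation_sum_weighted_mass_square_Cons[OF n, of x ps g]
    show "measure_pmf.expectation (pmf_of_set (index_pairs n)) (\<lambda>p. \<Sum>l=1..n. (weighted_mass x (p # ps) g l)\<^sup>2)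
      \<le> (1 - 2 / n) * (\<Sum>l=1..n. (weighted_mass x ps g l)\<^sup>2)
        + 1 / n * (\<Sum>l=1..n. (weighted_mass x ps ?h l)\<^sup>2) + 1 / (n * (real n - 1))"
      by linarith
  qed
  also have "\<dots> = (1 - 2 / n) * ?E (\<lambda>ps. \<Sum>l=1..n. (weighted_mass x ps g l)\<^sup>2)
      + 1 / n * ?E (\<lambda>ps. \<Sum>l=1..n. (weighted_mass x ps ?h l)\<^sup>2) + 1 / (n * (real n - 1))"
    by (simp add: n Bochner_Integration.integral_add del: Bochner_Integration.integral_sum)
  also have "\<dots> \<le> (1 - 2 / n) * (c + 1 / (real n - 1)) + 1 / n * (2 * c + 1 / (real n - 1)) + 1 / (n * (real n - 1))"
  proof (intro add_mono mult_left_mono order_refl)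
    show "?E (\<lambda>ps. \<Sum>l=1..n. (weighted_mass x ps g l)\<^sup>2) \<le> c + 1 / (real n - 1)"
      by (rule Suc.IH) (use Suc.prems in auto)
    show "?E (\<lambda>ps. \<Sum>l=1..n. (weighted_mass x ps ?h l)\<^sup>2) \<le> 2 * c + 1 / (real n - 1)"
    proof (rule Suc.IH)
      show "(g (Suc m))\<^sup>2 \<le> 2 * c * 2 ^ m" for m using Suc.prems(3)[of "Suc m"] by simp
    qed (use Suc.prems in auto)
  qed (use n' in auto)
  also have "\<dots> = c + 1 / (real n - 1)"
    using n' by (simp add: divide_simps) (simp add: algebra_simps)
  finally show ?case .
qed

text \<open>Each step adds to the variance at most (2/n) d^2 times the current sum of squares of the
  chain, because a touch changes the weight by at most \<open>d\<close>. The summand with index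
  \<open>l\<close> bounds the expected sum of squares after \<open>l\<close> steps.\<close>

lemma expectation_square_sum_weighted_mass:
  assumes n: "2 \<le> n" and x: "\<And>i. i \<in> {1..n} \<Longrightarrow> 0 \<le> x i" "(\<Sum>l=1..n. x l) = 1"
    and f: "\<And>m. \<bar>f (Suc m) - f m\<bar> \<le> d"
  shows "measure_pmf.expectation (pair_lists n k) (\<lambda>ps. (\<Sum>l=1..n. weighted_mass x ps f l)\<^sup>2)
    \<le> ((touch_step n ^^ k) f 0)\<^sup>2 + 2 / n * d\<^sup>2 * (\<Sum>l<k. (1 - 1 / n) ^ l + 1 / (real n - 1))"
  using f
proof (induction k arbitrary: f)
  case 0
  show ?case using x by (simp add: sum_distrib_right[symmetric])
next
  case (Suc k)
  let ?E = "measure_pmf.expectation (pair_lists n k)"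
  let ?d = "\<lambda>m. f (Suc m) - f m"
  have n': "real n \<ge> 2" using n by simp
  have sq: "(\<Sum>l=1..n. (x l)\<^sup>2) \<le> 1"
    using sum_squares_le_square_sum[of "{1..n}" x] x by auto
  have "measure_pmf.expectation (pair_lists n (Suc k)) (\<lambda>ps. (\<Sum>l=1..n. weighted_mass x ps f l)\<^sup>2)
    \<le> ?E (\<lambda>ps. (\<Sum>l=1..n. weighted_mass x ps (touch_step n f) l)\<^sup>2
        + 2 / n * d\<^sup>2 * (\<Sum>l=1..n. (average_pairs ps x l)\<^sup>2))"
    unfolding expectation_pair_lists_Suc[OF n]
  proof (rule expectation_pair_lists_mono[OF n])
    fix ps assume ps: "set ps \<subseteq> index_pairs n"
    have "(weighted_mass x ps ?d l)\<^sup>2 \<le> d\<^sup>2 * (average_pairs ps x l)\<^sup>2" if "l \<in> {1..n}" for l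
    proof -
      have d: "- d \<le> ?d m" "?d m \<le> d" for m
        using Suc.prems[of m] by (simp_all add: abs_le_iff)
      have "weighted_mass x ps ?d l \<le> weighted_mass x ps (\<lambda>m. d * 1) l"
        by (rule weighted_mass_mono) (use ps x that d in auto)
      moreover have "weighted_mass x ps (\<lambda>m. - d * 1) l \<le> weighted_mass x ps ?d l"
        by (rule weighted_mass_mono) (use ps x that d in auto)
      ultimately have "\<bar>weighted_mass x ps ?d l\<bar> \<le> d * average_pairs ps x l"
        unfolding weighted_mass_cmult weighted_mass_const by (simp add: abs_le_iff)
      then show ?thesis
        by (metis abs_ge_zero power2_abs power_mono power_mult_distrib)
    qed
    then have "2 / n * (\<Sum>l=1..n. (weighted_mass x ps ?d l)\<^sup>2) \<le> 2 / n * (d\<^sup>2 * (\<Sum>l=1..n. (average_pairs ps x l)\<^sup>2))"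
      unfolding sum_distrib_left by (intro mult_left_mono sum_mono) auto
    with expectation_square_sum_weighted_mass_Cons[OF n, of x ps f]
    show "measure_pmf.expectation (pmf_of_set (index_pairs n)) (\<lambda>p. (\<Sum>l=1..n. weighted_mass x (p # ps) f l)\<^sup>2)
      \<le> (\<Sum>l=1..n. weighted_mass x ps (touch_step n f) l)\<^sup>2
        + 2 / n * d\<^sup>2 * (\<Sum>l=1..n. (average_pairs ps x l)\<^sup>2)"
      by (simp only: mult.assoc)
  qed
  also have "\<dots> = ?E (\<lambda>ps. (\<Sum>l=1..n. weighted_mass x ps (touch_step n f) l)\<^sup>2)
      + 2 / n * d\<^sup>2 * ?E (\<lambda>ps. \<Sum>l=1..n. (average_pairs ps x l)\<^sup>2)"
    by (simp add: n Bochner_Integration.integral_add del: Bochner_Integration.integral_sum)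
  also have "\<dots> \<le> (((touch_step n ^^ k) (touch_step n f) 0)\<^sup>2
        + 2 / n * d\<^sup>2 * (\<Sum>l<k. (1 - 1 / n) ^ l + 1 / (real n - 1)))
      + 2 / n * d\<^sup>2 * ((1 - 1 / n) ^ k + 1 / (real n - 1))"
  proof (intro add_mono mult_left_mono)
    \<comment> \<open>\<open>touch_step\<close> mixes \<open>f\<close> with its own shift, so the
      slope bound \<open>d\<close> persists.\<close>
    have "\<bar>touch_step n f (Suc m) - touch_step n f m\<bar> \<le> d" for m
    proof -
      have "\<bar>touch_step n f (Suc m) - touch_step n f m\<bar>
        = \<bar>(1 - 2 / n) * ?d m + 2 / n * ?d (Suc m)\<bar>"
        by (simp add: touch_step_def algebra_simps diff_divide_distrib)
      also have "\<dots> \<le> (1 - 2 / n) * \<bar>?d m\<bar> + 2 / n * \<bar>?d (Suc m)\<bar>"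
        using n' by (intro order_trans[OF abs_triangle_ineq] add_mono) (simp_all only: abs_mult, simp_all)
      also have "\<dots> \<le> (1 - 2 / n) * d + 2 / n * d"
        using n' Suc.prems by (intro add_mono mult_left_mono) auto
      finally show ?thesis by (simp add: algebra_simps)
    qed
    then show "?E (\<lambda>ps. (\<Sum>l=1..n. weighted_mass x ps (touch_step n f) l)\<^sup>2)
      \<le> ((touch_step n ^^ k) (touch_step n f) 0)\<^sup>2
        + 2 / n * d\<^sup>2 * (\<Sum>l<k. (1 - 1 / n) ^ l + 1 / (real n - 1))"
      by (rule Suc.IH)
    have "(1 - 1 / n) ^ k * (\<Sum>l=1..n. (x l)\<^sup>2) \<le> (1 - 1 / n) ^ k * 1"
      using sq n' by (intro mult_left_mono) auto
    then show "?E (\<lambda>ps. \<Sum>l=1..n. (average_pairs ps x l)\<^sup>2) \<le> (1 - 1 / n) ^ k + 1 / (real n - 1)"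
      using expectation_sum_squares[OF n, of k x] x by simp
  qed auto
  also have "\<dots> = ((touch_step n ^^ Suc k) f 0)\<^sup>2
      + 2 / n * d\<^sup>2 * (\<Sum>l<Suc k. (1 - 1 / n) ^ l + 1 / (real n - 1))"
    by (simp only: funpow_Suc_right o_apply sum.lessThan_Suc distrib_left add.assoc)
  finally show ?case .
qed

subsection \<open>A non-asymptotic bound\<close>

text \<open>The Markov property at time \<open>k\<close>: with the newest pair at the head, the last
  \<open>r\<close> pairs form the prefix \<open>qs\<close>.\<close>

lemma expectation_pair_lists_add:
  fixes F :: "(nat \<times> nat) list \<Rightarrow> real"
  assumes "2 \<le> n"
  shows "measure_pmf.expectation (pair_lists n (k + r)) F
    = measure_pmf.expectation (pair_lists n k)
        (\<lambda>ps. measure_pmf.expectation (pair_lists n r) (\<lambda>qs. F (qs @ ps)))"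
proof (induction r arbitrary: F)
  case (Suc r)
  then show ?case
    by (simp only: add_Suc_right expectation_pair_lists_Suc[OF assms] append_Cons)
qed simp

section \<open>Averaging as a linear contraction in L1\<close>

lemma average_pairs_append: "average_pairs (qs @ ps) x = average_pairs qs (average_pairs ps x)"
  by (simp add: average_pairs_def)

lemma average_pairs_add:
  "average_pairs ps (\<lambda>l. v l + w l) = (\<lambda>l. average_pairs ps v l + average_pairs ps w l)"
  by (induction ps) (auto simp: average_pair_def field_simps)

lemma average_pairs_diff:
  "average_pairs ps (\<lambda>l. v l - w l) = (\<lambda>l. average_pairs ps v l - average_pairs ps w l)"
  by (induction ps) (auto simp: average_pair_def field_simps)

lemma average_pairs_const: "average_pairs ps (\<lambda>_. c) = (\<lambda>_. c)"
  by (induction ps) (auto simp: average_pair_def)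

lemma sum_abs_average_pairs:
  assumes "set ps \<subseteq> index_pairs n"
  shows "(\<Sum>l=1..n. \<bar>average_pairs ps v l\<bar>) \<le> (\<Sum>l=1..n. \<bar>v l\<bar>)"
  using assms
proof (induction ps)
  case (Cons p ps)
  obtain i j where p: "p = (i, j)" by force
  with Cons.prems have ij: "(i, j) \<in> index_pairs n" by simp
  let ?v = "average_pairs ps v"
  have "(\<Sum>l=1..n. \<bar>average_pairs (p # ps) v l\<bar>)
      = (\<Sum>l=1..n. if l = i \<or> l = j then \<bar>(?v i + ?v j) / 2\<bar> else \<bar>?v l\<bar>)"
    by (intro sum.cong) (auto simp: p average_pair_def)
  also have "\<dots> \<le> (\<Sum>l=1..n. \<bar>?v l\<bar>)"
    unfolding sum_replace_pair[OF ij] by simp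
  finally show ?case using Cons by simp
qed simp

lemma sum_abs_le_sqrt_card:
  fixes v :: "nat \<Rightarrow> real"
  shows "(\<Sum>l=1..n. \<bar>v l\<bar>)\<^sup>2 \<le> n * (\<Sum>l=1..n. (v l)\<^sup>2)"
  using sum_squared_le_sum_of_squares[of "\<lambda>l. \<bar>v l\<bar>" "{1..n}"] by (simp add: mult.commute)

text \<open>\<open>y\<close> and \<open>z\<close> are centred separately: their means add up to
  \<open>1 / n\<close>, and averaging is linear and fixes constants. For the centred
  \<open>z\<close>, averaging contracts L1 and the triangle inequality gives twice the
  total.\<close>

lemma L1_dev_average_pairs_le:
  assumes n: "1 \<le> n" and qs: "set qs \<subseteq> index_pairs n" and sum: "(\<Sum>l=1..n. y l + z l) = 1"
    and z: "\<And>l. l \<in> {1..n} \<Longrightarrow> 0 \<le> z l"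
  defines "v \<equiv> \<lambda>l. y l - (\<Sum>i=1..n. y i) / n"
  shows "L1_dev n (average_pairs qs (\<lambda>l. y l + z l))
    \<le> (\<Sum>l=1..n. \<bar>average_pairs qs v l\<bar>) + 2 * (\<Sum>l=1..n. z l)"
proof -
  let ?Z = "\<Sum>l=1..n. z l" and ?Y = "\<Sum>l=1..n. y l"
  let ?w = "\<lambda>l. z l - ?Z / n"
  have YZ: "?Y / n + ?Z / n = 1 / n"
    using sum by (simp add: sum.distrib add_divide_distrib[symmetric])
  have Z0: "0 \<le> ?Z" using z by (intro sum_nonneg) auto
  have "average_pairs qs (\<lambda>l. y l + z l) l - 1 / n = average_pairs qs v l + average_pairs qs ?w l" for l
    unfolding v_def average_pairs_add average_pairs_diff average_pairs_const using YZ by simp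
  then have "L1_dev n (average_pairs qs (\<lambda>l. y l + z l))
      \<le> (\<Sum>l=1..n. \<bar>average_pairs qs v l\<bar> + \<bar>average_pairs qs ?w l\<bar>)"
    unfolding L1_dev_def by (intro sum_mono) simp
  also have "\<dots> = (\<Sum>l=1..n. \<bar>average_pairs qs v l\<bar>) + (\<Sum>l=1..n. \<bar>average_pairs qs ?w l\<bar>)"
    by (rule sum.distrib)
  also have "(\<Sum>l=1..n. \<bar>average_pairs qs ?w l\<bar>) \<le> (\<Sum>l=1..n. \<bar>?w l\<bar>)"
    by (rule sum_abs_average_pairs[OF qs])
  also have "\<dots> \<le> (\<Sum>l=1..n. z l + ?Z / n)"
    using z Z0 by (intro sum_mono order_trans[OF abs_triangle_ineq4]) auto
  also have "\<dots> = 2 * ?Z" using n by (simp add: sum.distrib)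
  finally show ?thesis by simp
qed

text \<open>Chebyshev's inequality for two errors: \<open>Z\<close>, the total of the
  \<open>f\<close>-weighted mass, has variance governed by the slope \<open>d\<close>; the remaining
  mass, whose squares are governed by \<open>c\<close>, is flattened during the last
  \<open>r\<close> steps.\<close>

lemma prob_L1_dev_le:
  fixes k r :: nat
  assumes n: "2 \<le> n" and x: "\<And>i. i \<in> {1..n} \<Longrightarrow> 0 \<le> x i" "(\<Sum>l=1..n. x l) = 1"
    and f: "\<And>m. 0 \<le> f m" "\<And>m. f m \<le> 1" "\<And>m. \<bar>f (Suc m) - f m\<bar> \<le> d" "\<And>m. (1 - f m)\<^sup>2 \<le> c * 2 ^ m"
    and \<eta>: "0 < \<eta>"
  defines "\<mu> \<equiv> (touch_step n ^^ k) f 0"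
  shows "measure_pmf.prob (averaging_chain n x (k + r)) {x. L1_dev n x > 2 * \<mu> + 3 * \<eta>}
    \<le> (2 * d\<^sup>2 * (1 + k / (n * (real n - 1))) + n * (1 - 1 / n) ^ r * (c + 1 / (real n - 1))) / \<eta>\<^sup>2"
proof -
  let ?E = "measure_pmf.expectation (pair_lists n k)"
  let ?R = "measure_pmf.expectation (pair_lists n r)"
  let ?y = "\<lambda>ps. weighted_mass x ps (\<lambda>m. 1 - f m)"
  let ?z = "\<lambda>ps. weighted_mass x ps f"
  define Z where "Z ps = (\<Sum>l=1..n. ?z ps l)" for ps
  define v where "v ps = (\<lambda>l. ?y ps l - (\<Sum>i=1..n. ?y ps i) / n)" for ps
  define A where "A = {x. L1_dev n x > 2 * \<mu> + 3 * \<eta>}"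
  have n': "real n \<ge> 2" using n by simp
  have "measure_pmf.prob (averaging_chain n x (k + r)) A
      = measure_pmf.expectation (pair_lists n (k + r)) (\<lambda>ps. indicator A (average_pairs ps x))"
  proof -
    have "measure_pmf.prob (averaging_chain n x (k + r)) A
        = measure_pmf.expectation (averaging_chain n x (k + r)) (indicat_real A)"
      by simp
    also have "\<dots> = measure_pmf.expectation (pair_lists n (k + r)) (\<lambda>ps. indicat_real A (average_pairs ps x))"
      unfolding averaging_chain_conv_pair_lists by (rule integral_map_pmf)
    finally show ?thesis .
  qed
  also have "\<dots> = ?E (\<lambda>ps. ?R (\<lambda>qs. indicator A (average_pairs qs (average_pairs ps x))))"
    unfolding expectation_pair_lists_add[OF n] average_pairs_append ..
  also have "\<dots> \<le> ?E (\<lambda>ps. ((Z ps - \<mu>)\<^sup>2 + n * (1 - 1 / n) ^ r * (\<Sum>l=1..n. (?y ps l)\<^sup>2)) / \<eta>\<^sup>2)"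
  proof (rule expectation_pair_lists_mono[OF n])
    fix ps assume ps: "set ps \<subseteq> index_pairs n"
    have split: "average_pairs ps x = (\<lambda>l. ?y ps l + ?z ps l)"
      by (simp add: fun_eq_iff weighted_mass_const flip: weighted_mass_add)
    have "?R (\<lambda>qs. indicator A (average_pairs qs (average_pairs ps x)))
        \<le> ?R (\<lambda>qs. ((Z ps - \<mu>)\<^sup>2 + n * (\<Sum>l=1..n. (average_pairs qs (v ps) l)\<^sup>2)) / \<eta>\<^sup>2)"
    proof (rule expectation_pair_lists_mono[OF n])
      fix qs assume qs: "set qs \<subseteq> index_pairs n"
      let ?a = "\<Sum>l=1..n. \<bar>average_pairs qs (v ps) l\<bar>"
      let ?b = "n * (\<Sum>l=1..n. (average_pairs qs (v ps) l)\<^sup>2)"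
      \<comment> \<open>Cauchy-Schwarz: the contraction is known for sums of squares, and the
        passage from L1 costs a factor \<open>n\<close>.\<close>
      have ab: "?a\<^sup>2 \<le> ?b" by (rule sum_abs_le_sqrt_card)
      have "L1_dev n (average_pairs qs (average_pairs ps x)) \<le> ?a + 2 * Z ps"
        unfolding split Z_def v_def
      proof (rule L1_dev_average_pairs_le[OF _ qs])
        show "(\<Sum>l=1..n. ?y ps l + ?z ps l) = 1"
          using sum_average_pairs[OF ps, of x] x(2) by (simp add: split)
        show "0 \<le> ?z ps l" if "l \<in> {1..n}" for l
          by (rule weighted_mass_nonneg) (use ps x f that in auto)
      qed (use n in simp)
      \<comment> \<open>The excess \<open>3 * \<eta>\<close> is shared out as
        \<open>2 * \<eta>\<close> for \<open>2 * Z ps\<close> and one \<open>\<eta>\<close> for the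
        flattened part \<open>?a\<close>.\<close>
      then have "\<eta> < Z ps - \<mu> \<or> \<eta> < ?a" if "average_pairs qs (average_pairs ps x) \<in> A"
        using that unfolding A_def by auto
      then have "\<eta>\<^sup>2 \<le> (Z ps - \<mu>)\<^sup>2 \<or> \<eta>\<^sup>2 \<le> ?a\<^sup>2" if "average_pairs qs (average_pairs ps x) \<in> A"
        using that \<eta> by (meson less_imp_le power_mono)
      moreover have "0 \<le> (Z ps - \<mu>)\<^sup>2" "0 \<le> ?a\<^sup>2" by simp_all
      ultimately have "\<eta>\<^sup>2 \<le> (Z ps - \<mu>)\<^sup>2 + ?b" if "average_pairs qs (average_pairs ps x) \<in> A"
        using that ab by linarith
      moreover have "0 \<le> (Z ps - \<mu>)\<^sup>2 + ?b" by (simp add: sum_nonneg)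
      ultimately show "indicator A (average_pairs qs (average_pairs ps x)) \<le> ((Z ps - \<mu>)\<^sup>2 + ?b) / \<eta>\<^sup>2"
        using \<eta> by (auto simp: indicator_def)
    qed
    also have "\<dots> = ((Z ps - \<mu>)\<^sup>2 + n * ?R (\<lambda>qs. \<Sum>l=1..n. (average_pairs qs (v ps) l)\<^sup>2)) / \<eta>\<^sup>2"
      by (simp add: n del: Bochner_Integration.integral_sum)
    also have "\<dots> \<le> ((Z ps - \<mu>)\<^sup>2 + n * ((1 - 1 / n) ^ r * (\<Sum>l=1..n. (?y ps l)\<^sup>2))) / \<eta>\<^sup>2"
    proof (intro divide_right_mono add_left_mono mult_left_mono)
      let ?Y = "\<Sum>l=1..n. ?y ps l"
      \<comment> \<open>Centring removes the additive term of
        \<open>expectation_sum_squares\<close>; multiplied by the factor \<open>n\<close> that term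
        could be of order 1.\<close>
      have "(\<Sum>l=1..n. v ps l) = 0" using n by (simp add: v_def sum_subtractf)
      then have "?R (\<lambda>qs. \<Sum>l=1..n. (average_pairs qs (v ps) l)\<^sup>2) \<le> (1 - 1 / n) ^ r * (\<Sum>l=1..n. (v ps l)\<^sup>2)"
        using expectation_sum_squares[OF n, of r "v ps"] by simp
      also have "(\<Sum>l=1..n. (v ps l)\<^sup>2) = (\<Sum>l=1..n. (?y ps l)\<^sup>2 - 2 * ?Y / n * ?y ps l + ?Y\<^sup>2 / (real n)\<^sup>2)"
        unfolding v_def by (intro sum.cong) (auto simp: power2_eq_square field_simps)
      also have "\<dots> = (\<Sum>l=1..n. (?y ps l)\<^sup>2) - ?Y\<^sup>2 / n"
        unfolding sum.distrib sum_subtractf sum_distrib_left[symmetric]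
        using n' by (simp add: power2_eq_square)
      also have "(1 - 1 / n) ^ r * \<dots> \<le> (1 - 1 / n) ^ r * (\<Sum>l=1..n. (?y ps l)\<^sup>2)"
        using n' by (intro mult_left_mono) auto
      finally show "?R (\<lambda>qs. \<Sum>l=1..n. (average_pairs qs (v ps) l)\<^sup>2) \<le> (1 - 1 / n) ^ r * (\<Sum>l=1..n. (?y ps l)\<^sup>2)" .
    qed auto
    finally show "?R (\<lambda>qs. indicator A (average_pairs qs (average_pairs ps x)))
        \<le> ((Z ps - \<mu>)\<^sup>2 + n * (1 - 1 / n) ^ r * (\<Sum>l=1..n. (?y ps l)\<^sup>2)) / \<eta>\<^sup>2"
      by (simp add: mult.assoc)
  qed
  also have "\<dots> = (?E (\<lambda>ps. (Z ps - \<mu>)\<^sup>2) + n * (1 - 1 / n) ^ r * ?E (\<lambda>ps. \<Sum>l=1..n. (?y ps l)\<^sup>2)) / \<eta>\<^sup>2"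
    by (simp add: n del: Bochner_Integration.integral_sum)
  also have "\<dots> \<le> (2 * d\<^sup>2 * (1 + k / (n * (real n - 1))) + n * (1 - 1 / n) ^ r * (c + 1 / (real n - 1))) / \<eta>\<^sup>2"
  proof (intro divide_right_mono add_mono mult_left_mono)
    have "?E (\<lambda>ps. (Z ps - \<mu>)\<^sup>2) = ?E (\<lambda>ps. (Z ps)\<^sup>2 - 2 * \<mu> * Z ps + \<mu>\<^sup>2)"
      by (simp add: power2_diff algebra_simps)
    also have "\<dots> = ?E (\<lambda>ps. (Z ps)\<^sup>2) - 2 * \<mu> * ?E Z + \<mu>\<^sup>2"
      by (simp add: n)
    also have "?E Z = \<mu>"
      using expectation_sum_weighted_mass[OF n, of k x f] x(2) unfolding Z_def[abs_def] \<mu>_def by simp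
    also have "?E (\<lambda>ps. (Z ps)\<^sup>2) \<le> \<mu>\<^sup>2 + 2 / n * d\<^sup>2 * (\<Sum>l<k. (1 - 1 / n) ^ l + 1 / (real n - 1))"
      unfolding Z_def \<mu>_def by (rule expectation_square_sum_weighted_mass) (use n x f in auto)
    also have "(\<Sum>l<k. (1 - 1 / n) ^ l + 1 / (real n - 1)) = (\<Sum>l<k. (1 - 1 / n) ^ l) + k / (real n - 1)"
      by (simp add: sum.distrib)
    \<comment> \<open>The geometric sum is at most \<open>n\<close> for every \<open>k\<close>;
      against the factor 2/n it leaves the constant 2, and \<open>k\<close> enters only through k/(n
      (n - 1)).\<close>
    also have "(\<Sum>l<k. (1 - 1 / real n) ^ l) \<le> n"
    proof -
      have "(\<Sum>l<k. (1 - 1 / real n) ^ l) = real n * (1 - (1 - 1 / real n) ^ k)"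
        unfolding sum_gp_strict using n' by simp
      also have "\<dots> \<le> real n * 1" using n' by (intro mult_left_mono) auto
      finally show ?thesis by simp
    qed
    finally have "?E (\<lambda>ps. (Z ps - \<mu>)\<^sup>2) \<le> 2 / n * d\<^sup>2 * (n + k / (real n - 1))"
      using n' by (simp add: power2_eq_square divide_right_mono mult_left_mono)
    also have "\<dots> = 2 * d\<^sup>2 * (1 + k / (n * (real n - 1)))"
      using n' by (simp add: field_simps)
    finally show "?E (\<lambda>ps. (Z ps - \<mu>)\<^sup>2) \<le> 2 * d\<^sup>2 * (1 + k / (n * (real n - 1)))" .
    show "?E (\<lambda>ps. \<Sum>l=1..n. (?y ps l)\<^sup>2) \<le> c + 1 / (real n - 1)"
      by (rule expectation_weighted_mass_squares_le) (use n x f in auto)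
  qed (use n' in auto)
  finally show ?thesis by (simp add: A_def)
qed

subsection \<open>Normal approximation of the number of halvings\<close>

text \<open>Each application of \<open>touch_step\<close> adds an independent success of probability
  2/n to the halving count.\<close>

lemma funpow_touch_step:
  assumes n: "2 \<le> n"
  shows "(touch_step n ^^ k) f m = measure_pmf.expectation (binomial_pmf k (2 / n)) (\<lambda>b. f (m + b))"
proof (induction k arbitrary: m)
  case 0
  show ?case using n by (simp add: binomial_pmf_0)
next
  case (Suc k)
  have p: "2 / real n \<in> {0..1}" using n by auto
  have "measure_pmf.expectation (binomial_pmf (Suc k) (2 / n)) (\<lambda>b. f (m + b))
    = 2 / n * measure_pmf.expectation (binomial_pmf k (2 / n)) (\<lambda>b. f (Suc m + b))
      + (1 - 2 / n) * measure_pmf.expectation (binomial_pmf k (2 / n)) (\<lambda>b. f (m + b))"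
    unfolding binomial_pmf_Suc[OF p] using p
    by (subst pmf_expectation_bind[of UNIV])
       (auto simp: UNIV_bool finite_set_pmf_binomial_pmf map_pmf_def[symmetric])
  moreover have "(touch_step n ^^ Suc k) f m
      = (1 - 2 / n) * (touch_step n ^^ k) f m + 2 / n * (touch_step n ^^ k) f (Suc m)"
    by (simp add: touch_step_def[of n "(touch_step n ^^ k) f"])
  ultimately show ?case by (simp add: Suc)
qed

section \<open>Central limit theorem for binomials with varying parameters\<close>

lemma expectation_binomial_pmf_power:
  fixes z :: complex
  assumes "p \<in> {0..1}"
  shows "measure_pmf.expectation (binomial_pmf N p) (\<lambda>b. z ^ b) = (complex_of_real p * z + (1 - p)) ^ N"
  unfolding expectation_binomial_pmf'[OF assms] binomial_ring
  by (intro sum.cong) (auto simp: scaleR_conv_of_real power_mult_distrib algebra_simps)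

text \<open>The binomial generating function at \<open>iexp (t / s)\<close>, with the centring
  factor distributed over the trials. The base is the characteristic function of one centred
  Bernoulli variable, ready for Taylor expansion.\<close>

lemma char_binomial:
  assumes p: "p \<in> {0..1}"
  shows "char (distr (measure_pmf (binomial_pmf N p)) borel (\<lambda>b. (real b - real N * p) / s)) t
    = (complex_of_real (1 - p) * iexp (- p * (t / s)) + p * iexp ((1 - p) * (t / s))) ^ N"
proof -
  have "char (distr (measure_pmf (binomial_pmf N p)) borel (\<lambda>b. (real b - real N * p) / s)) t
    = measure_pmf.expectation (binomial_pmf N p) (\<lambda>b. iexp (t * ((real b - real N * p) / s)))"
    by (simp add: char_def integral_distr)
  also have "\<dots> = measure_pmf.expectation (binomial_pmf N p) (\<lambda>b. iexp (- p * (t / s)) ^ N * iexp (t / s) ^ b)"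
    by (intro arg_cong2[where f = "integral\<^sup>L"] refl ext)
       (simp add: exp_of_nat_mult[symmetric] exp_add[symmetric] algebra_simps diff_divide_distrib)
  also have "\<dots> = iexp (- p * (t / s)) ^ N * (p * iexp (t / s) + (1 - p)) ^ N"
    by (simp add: expectation_binomial_pmf_power[OF p])
  also have "\<dots> = ((1 - p) * iexp (- p * (t / s)) + p * (iexp (t / s) * iexp (- p * (t / s)))) ^ N"
    by (simp add: power_mult_distrib[symmetric] algebra_simps)
  also have "iexp (t / s) * iexp (- p * (t / s)) = iexp ((1 - p) * (t / s))"
    by (simp add: exp_add[symmetric] algebra_simps diff_divide_distrib)
  finally show ?thesis .
qed

lemma exp_minus_bounds:
  fixes y :: real
  assumes "0 \<le> y"
  shows "\<bar>(1 - y) - exp (- y)\<bar> \<le> y\<^sup>2"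
proof -
  have "exp (- y) \<le> 1 / (1 + y)"
    using exp_ge_add_one_self[of y] assms by (simp add: exp_minus field_simps)
  also have "\<dots> \<le> 1 - y + y\<^sup>2"
    using assms by (simp add: divide_simps) (simp add: power2_eq_square algebra_simps)
  finally show ?thesis using exp_ge_add_one_self[of "- y"] by simp
qed

text \<open>Taylor expansion to second order: centring kills the linear term and the quadratic one
  carries the variance p (1 - p). Each error keeps a factor \<open>p\<close>, so N trials cost N p
  times third and fourth powers of \<open>u\<close>, which is small when N p is large and u^2 has
  order 1/(N p).\<close>

lemma centred_bernoulli_char_approx:
  fixes p u :: real
  assumes p: "p \<in> {0..1}"
  shows "cmod ((1 - p) * iexp (- p * u) + p * iexp ((1 - p) * u) - exp (- (p * (1 - p) * u\<^sup>2 / 2)))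
    \<le> p * \<bar>u\<bar> ^ 3 + p * u ^ 4"
proof -
  define R where "R x = iexp x - (1 + \<i> * x - x\<^sup>2 / 2)" for x :: real
  have R: "cmod (R x) \<le> \<bar>x\<bar> ^ 3 / 6" for x
    using iexp_approx1[of x 2] by (simp add: R_def numeral_eq_Suc power_mult_distrib algebra_simps fact_numeral)
  let ?y = "p * (1 - p) * u\<^sup>2 / 2"
  have y: "0 \<le> ?y" using p by auto
  have "(1 - p) * iexp (- p * u) + p * iexp ((1 - p) * u) - exp (- ?y)
    = (1 - p) * R (- p * u) + p * R ((1 - p) * u) + complex_of_real ((1 - ?y) - exp (- ?y))"
    by (simp add: R_def power2_eq_square field_simps)
  also have "cmod \<dots> \<le> (1 - p) * cmod (R (- p * u)) + p * cmod (R ((1 - p) * u)) + \<bar>(1 - ?y) - exp (- ?y)\<bar>"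
  proof -
    have "cmod ((1 - p) * R (- p * u)) = (1 - p) * cmod (R (- p * u))"
      "cmod (p * R ((1 - p) * u)) = p * cmod (R ((1 - p) * u))"
      using p by (simp_all add: norm_mult del: of_real_diff flip: of_real_diff)
    moreover have "cmod (a + b + c) \<le> cmod a + cmod b + cmod c" for a b c
      using norm_triangle_ineq[of "a + b" c] norm_triangle_ineq[of a b] by simp
    ultimately show ?thesis by (metis norm_of_real)
  qed
  also have "\<dots> \<le> p * (\<bar>u\<bar> ^ 3 / 6) + p * (\<bar>u\<bar> ^ 3 / 6) + p * u ^ 4"
  proof (intro add_mono)
    have "(1 - p) * cmod (R (- p * u)) \<le> 1 * (\<bar>- p * u\<bar> ^ 3 / 6)"
      using p R[of "- p * u"] by (intro mult_mono) auto
    also have "\<dots> = p ^ 3 * (\<bar>u\<bar> ^ 3 / 6)"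
      using p by (simp add: abs_mult power_mult_distrib)
    also have "\<dots> \<le> p * (\<bar>u\<bar> ^ 3 / 6)"
      using p power_decreasing[of 1 3 p] by (intro mult_right_mono) auto
    finally show "(1 - p) * cmod (R (- p * u)) \<le> p * (\<bar>u\<bar> ^ 3 / 6)" .
    have "cmod (R ((1 - p) * u)) \<le> (1 - p) ^ 3 * \<bar>u\<bar> ^ 3 / 6"
      using p R[of "(1 - p) * u"] by (simp add: abs_mult power_mult_distrib)
    also have "\<dots> \<le> 1 * \<bar>u\<bar> ^ 3 / 6"
      using p by (intro divide_right_mono mult_right_mono power_le_one) auto
    finally show "p * cmod (R ((1 - p) * u)) \<le> p * (\<bar>u\<bar> ^ 3 / 6)"
      using p by (intro mult_left_mono) auto
    have "\<bar>(1 - ?y) - exp (- ?y)\<bar> \<le> ?y\<^sup>2" by (rule exp_minus_bounds[OF y])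
    also have "?y\<^sup>2 = p * (p * (1 - p)\<^sup>2 / 4) * u ^ 4"
      by (simp add: power_mult_distrib power_divide power2_eq_square numeral_eq_Suc)
    also have "\<dots> \<le> p * 1 * u ^ 4"
    proof (intro mult_right_mono mult_left_mono)
      have "p * (1 - p)\<^sup>2 \<le> 1 * 1" using p by (intro mult_mono power_le_one) auto
      then show "p * (1 - p)\<^sup>2 / 4 \<le> 1" by simp
    qed (use p in auto)
    finally show "\<bar>(1 - ?y) - exp (- ?y)\<bar> \<le> p * u ^ 4" by simp
  qed
  also have "\<dots> \<le> p * \<bar>u\<bar> ^ 3 + p * u ^ 4" using p by (simp add: field_simps)
  finally show ?thesis .
qed

text \<open>The normal law has no atoms. This serves the limit of distribution functions at every
  level and, later, the choice of \<open>\<delta>\<close>.\<close>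

lemma isCont_std_normal_cdf: "isCont std_normal_cdf c"
proof -
  interpret real_distribution std_normal_distribution by (rule real_dist_normal_dist)
  have "emeasure std_normal_distribution {c} = 0"
    by (simp add: emeasure_density nn_integral_null_set)
  then show ?thesis
    unfolding std_normal_cdf_def isCont_cdf by (simp add: measure_def)
qed

text \<open>Levy continuity for a triangular array. As \<open>p\<close> tends to 0, the variance N p
  (1 - p) is asymptotic to N p, hence the scale condition in terms of N p alone.\<close>

lemma binomial_tendsto_std_normal:
  fixes N :: "nat \<Rightarrow> nat" and p s :: "nat \<Rightarrow> real"
  assumes p: "\<And>n. p n \<in> {0..1}" "p \<longlonglongrightarrow> 0"
    and s: "filterlim s at_top sequentially"
    and var: "(\<lambda>n. N n * p n / (s n)\<^sup>2) \<longlonglongrightarrow> 1"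
  shows "(\<lambda>n. measure_pmf.prob (binomial_pmf (N n) (p n)) {b. (real b - N n * p n) / s n \<le> c})
    \<longlonglongrightarrow> std_normal_cdf c"
proof -
  define M where "M n = distr (measure_pmf (binomial_pmf (N n) (p n))) borel (\<lambda>b. (real b - N n * p n) / s n)" for n
  have dist: "real_distribution (M n)" for n
    unfolding M_def by (rule prob_space.real_distribution_distr[OF measure_pmf.prob_space_axioms]) simp
  have "weak_conv_m M std_normal_distribution"
  proof (rule levy_continuity[OF dist real_dist_normal_dist])
    fix t
    let ?u = "\<lambda>n. t / s n"
    let ?y = "\<lambda>n. p n * (1 - p n) * (?u n)\<^sup>2 / 2"
    let ?v = "\<lambda>n. N n * p n / (s n)\<^sup>2"
    let ?phi = "\<lambda>n. complex_of_real (1 - p n) * iexp (- p n * ?u n) + p n * iexp ((1 - p n) * ?u n)"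
    have s0: "\<forall>\<^sub>F n in sequentially. 0 < s n"
      using s by (simp add: filterlim_at_top_dense)
    have inv: "(\<lambda>n. \<bar>t\<bar> / s n) \<longlonglongrightarrow> 0"
      using s by (intro tendsto_divide_0[OF tendsto_const] filterlim_at_top_imp_at_infinity)
    have bound: "cmod (char (M n) t - exp (- (N n * ?y n))) \<le> N n * (p n * \<bar>?u n\<bar> ^ 3 + p n * ?u n ^ 4)" for n
    proof -
      have phi: "cmod (?phi n) \<le> 1"
      proof -
        have "cmod (?phi n) \<le> cmod ((1 - p n) * iexp (- p n * ?u n)) + cmod (p n * iexp ((1 - p n) * ?u n))"
          by (rule norm_triangle_ineq)
        also have "\<dots> = (1 - p n) + p n"
          using p(1)[of n] by (simp add: norm_mult del: of_real_diff flip: of_real_diff)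
        finally show ?thesis by simp
      qed
      have "char (M n) t = ?phi n ^ N n"
        unfolding M_def by (rule char_binomial[OF p(1)])
      moreover have "complex_of_real (exp (- (N n * ?y n))) = complex_of_real (exp (- ?y n)) ^ N n"
        by (simp add: exp_of_nat_mult[symmetric] flip: of_real_power)
      ultimately have "cmod (char (M n) t - exp (- (N n * ?y n))) = cmod (?phi n ^ N n - complex_of_real (exp (- ?y n)) ^ N n)"
        by simp
      \<comment> \<open>Both bases lie in the closed unit disc, so replacing the factors one at a
        time costs at most \<open>N n\<close> times a single difference.\<close>
      also have "\<dots> \<le> N n * cmod (?phi n - exp (- ?y n))"
        using phi p(1)[of n] by (intro norm_power_diff) auto
      also have "\<dots> \<le> N n * (p n * \<bar>?u n\<bar> ^ 3 + p n * ?u n ^ 4)"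
        by (intro mult_left_mono centred_bernoulli_char_approx p) auto
      finally show ?thesis .
    qed
    \<comment> \<open>The error bound rewritten as the convergent ratio \<open>?v n\<close> times
      powers of \<open>\<bar>t\<bar> / s n\<close>, which tends to 0.\<close>
    have "(\<lambda>n. ?v n * (t\<^sup>2 * (\<bar>t\<bar> / s n)) + ?v n * (t\<^sup>2 * (\<bar>t\<bar> / s n)\<^sup>2)) \<longlonglongrightarrow> 1 * (t\<^sup>2 * 0) + 1 * (t\<^sup>2 * 0\<^sup>2)"
      by (intro tendsto_intros var inv)
    then have "(\<lambda>n. ?v n * (t\<^sup>2 * (\<bar>t\<bar> / s n)) + ?v n * (t\<^sup>2 * (\<bar>t\<bar> / s n)\<^sup>2)) \<longlonglongrightarrow> 0"
      by simp
    then have "(\<lambda>n. N n * (p n * \<bar>?u n\<bar> ^ 3 + p n * ?u n ^ 4)) \<longlonglongrightarrow> 0"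
    proof (rule Lim_transform_eventually)
      show "\<forall>\<^sub>F n in sequentially. ?v n * (t\<^sup>2 * (\<bar>t\<bar> / s n)) + ?v n * (t\<^sup>2 * (\<bar>t\<bar> / s n)\<^sup>2)
          = N n * (p n * \<bar>?u n\<bar> ^ 3 + p n * ?u n ^ 4)"
        using s0
      proof eventually_elim
        case (elim n)
        have u: "\<bar>t\<bar> / s n = \<bar>?u n\<bar>" using elim by simp
        have v: "?v n * t\<^sup>2 = N n * p n * (?u n)\<^sup>2" by (simp add: power_divide)
        have "\<bar>?u n\<bar> ^ 3 = (?u n)\<^sup>2 * \<bar>?u n\<bar>" "?u n ^ 4 = (?u n)\<^sup>2 * \<bar>?u n\<bar>\<^sup>2"
          by (simp_all only: power2_abs) (simp_all add: numeral_eq_Suc flip: power2_abs)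
        then show ?case
          unfolding u mult.assoc[of "?v n", symmetric] v by (simp only: distrib_left mult.assoc)
      qed
    qed
    then have 1: "(\<lambda>n. char (M n) t - exp (- (N n * ?y n))) \<longlonglongrightarrow> 0"
      by (rule Lim_null_comparison[OF always_eventually[rule_format, OF bound]])
    have "(\<lambda>n. complex_of_real (exp (- (?v n * (1 - p n) * t\<^sup>2 / 2)))) \<longlonglongrightarrow> complex_of_real (exp (- (1 * (1 - 0) * t\<^sup>2 / 2)))"
      by (intro tendsto_intros var p) auto
    moreover have "?v n * (1 - p n) * t\<^sup>2 / 2 = N n * ?y n" for n
      by (simp add: power_divide)
    ultimately have 2: "(\<lambda>n. complex_of_real (exp (- (N n * ?y n)))) \<longlonglongrightarrow> complex_of_real (exp (- (t\<^sup>2 / 2)))"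
      by (simp only: mult_1 diff_0_right)
    from tendsto_add[OF 1 2] show "(\<lambda>n. char (M n) t) \<longlonglongrightarrow> char std_normal_distribution t"
      by (simp add: char_std_normal_distribution)
  qed
  then have "(\<lambda>n. cdf (M n) c) \<longlonglongrightarrow> cdf std_normal_distribution c"
    using isCont_std_normal_cdf[of c] by (simp add: weak_conv_m_def weak_conv_def std_normal_cdf_def)
  then show ?thesis
    by (simp add: std_normal_cdf_def cdf_def M_def measure_distr vimage_def)
qed

subsection \<open>Asymptotics at the cutoff\<close>

text \<open>Witnessed by the point mass at site 1; it ensures that the supremum in the theorem runs
  over a nonempty set.\<close>

lemma prob_vectors_nonempty:
  assumes "1 \<le> n"
  shows "prob_vectors n \<noteq> {}"
proof -
  have "(\<lambda>i\<in>{1..n}. if i = 1 then 1 else 0) \<in> prob_vectors n"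
    using assms by (auto simp: prob_vectors_def Rn_def sum.delta)
  then show ?thesis by blast
qed

text \<open>The ramp falling from 1 at \<open>L - w\<close> to 0 at \<open>L\<close> lies below the
  indicator of at most \<open>L\<close> halvings, so its mean is bounded by a binomial tail; its
  slope is \<open>1 / w\<close>.\<close>

lemma prob_L1_dev_tail_le:
  fixes K r :: nat and L w :: real
  assumes n: "2 \<le> n" and x: "x \<in> prob_vectors n" and w: "0 < w" and L: "L = log 2 n" and \<eta>: "0 < \<eta>"
    and tail: "2 * measure_pmf.prob (binomial_pmf K (2 / n)) {b. real b \<le> L} + 3 * \<eta> \<le> q"
  shows "measure_pmf.prob (averaging_chain n x (K + r)) {x. L1_dev n x > q}
    \<le> (2 * (1 / w)\<^sup>2 * (1 + K / (n * (real n - 1)))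
        + n * (1 - 1 / n) ^ r * (2 powr w / n + 1 / (real n - 1))) / \<eta>\<^sup>2"
proof -
  define f where "f m = max 0 (min 1 ((L - real m) / w))" for m
  define \<mu> where "\<mu> = (touch_step n ^^ K) f 0"
  have "\<mu> = measure_pmf.expectation (binomial_pmf K (2 / n)) f"
    using funpow_touch_step[OF n, of K f 0] by (simp add: \<mu>_def)
  also have "\<dots> \<le> measure_pmf.expectation (binomial_pmf K (2 / n)) (indicat_real {b. real b \<le> L})"
  proof (rule integral_mono)
    have "finite (set_pmf (binomial_pmf K (2 / n)))"
      using n by (intro finite_set_pmf_binomial_pmf) auto
    then show "integrable (measure_pmf (binomial_pmf K (2 / n))) f"
      "integrable (measure_pmf (binomial_pmf K (2 / n))) (indicat_real {b. real b \<le> L})"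
      by (simp_all add: integrable_measure_pmf_finite)
    show "f b \<le> indicat_real {b. real b \<le> L} b" for b
      using w by (auto simp: f_def indicator_def divide_nonpos_pos)
  qed
  finally have "2 * \<mu> + 3 * \<eta> \<le> q" using tail by simp
  then have "measure_pmf.prob (averaging_chain n x (K + r)) {x. L1_dev n x > q}
    \<le> measure_pmf.prob (averaging_chain n x (K + r)) {x. L1_dev n x > 2 * \<mu> + 3 * \<eta>}"
    by (intro measure_pmf.finite_measure_mono) auto
  also have "\<dots> \<le> (2 * (1 / w)\<^sup>2 * (1 + K / (n * (real n - 1)))
        + n * (1 - 1 / n) ^ r * (2 powr w / n + 1 / (real n - 1))) / \<eta>\<^sup>2"
    unfolding \<mu>_def
  proof (rule prob_L1_dev_le[OF n])
    show "\<bar>f (Suc m) - f m\<bar> \<le> 1 / w" for m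
    proof -
      have "(L - real (Suc m)) / w = (L - real m) / w - 1 / w"
        by (simp add: diff_divide_distrib add_divide_distrib)
      moreover have "0 \<le> 1 / w" using w by simp
      ultimately show ?thesis unfolding f_def by linarith
    qed
    \<comment> \<open>The left side vanishes unless \<open>m\<close> exceeds \<open>L - w\<close>,
      and then \<open>2 ^ m\<close> exceeds \<open>n / 2 powr w\<close>; this dictates
      \<open>c = 2 powr w / n\<close>.\<close>
    show "(1 - f m)\<^sup>2 \<le> 2 powr w / n * 2 ^ m" for m
    proof (cases "w \<le> L - m")
      case True
      then have "f m = 1" using w by (simp add: f_def)
      then show ?thesis by simp
    next
      case False
      have "(1 - f m)\<^sup>2 \<le> 1"
        by (rule power_le_one) (auto simp: f_def)
      also have "1 \<le> 2 powr (w + m - L)"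
        using False by (simp add: ge_one_powr_ge_zero)
      also have "\<dots> = 2 powr w / n * 2 ^ m"
        using n by (simp add: L powr_diff powr_add powr_realpow)
      finally show ?thesis .
    qed
  qed (use x \<eta> in \<open>auto simp: prob_vectors_def f_def\<close>)
  finally show ?thesis .
qed

text \<open>Since (1 - 1/n)^r <= exp (- r/n), about \<open>n * w\<close> steps gain exp (- w)
  against the loss \<open>2 powr w\<close> from the ramp, and 2 < e makes the gain win for large
  \<open>w\<close>. The 1 in the exponent absorbs the rounding of \<open>r\<close>.\<close>

lemma flattening_error_le:
  assumes n: "2 \<le> n" and r: "real n * w - 1 \<le> real r"
  shows "n * (1 - 1 / n) ^ r * (2 powr w / n + 1 / (real n - 1)) \<le> exp (1 - w) * (2 powr w + 2)"
proof -
  have n': "real n \<ge> 2" using n by simp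
  have "(1 - 1 / n) ^ r \<le> exp (- 1 / n) ^ r"
    using n' exp_ge_add_one_self[of "- 1 / n"] by (intro power_mono) auto
  also have "\<dots> = exp (- (r / n))" by (simp add: exp_of_nat_mult[symmetric])
  also have "\<dots> \<le> exp (1 - w)"
  proof -
    have "w - 1 \<le> w - 1 / n" using n' by simp
    also have "\<dots> = (real n * w - 1) / n" using n' by (simp add: diff_divide_distrib)
    also have "\<dots> \<le> r / n" using r by (intro divide_right_mono) auto
    finally show ?thesis by simp
  qed
  finally have "(1 - 1 / n) ^ r \<le> exp (1 - w)" .
  moreover have "n / (real n - 1) \<le> 2" using n' by (simp add: field_simps)
  ultimately have "(1 - 1 / n) ^ r * (2 powr w + n / (real n - 1)) \<le> exp (1 - w) * (2 powr w + 2)"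
    using n' by (intro mult_mono) auto
  then show ?thesis
    using n' by (simp add: distrib_left mult.commute mult.left_commute)
qed

theorem theorem1p3:
  fixes a \<epsilon> :: real
  assumes "\<epsilon> > 0"
  shows "(\<lambda>n. SUP x0 \<in> prob_vectors n.
            measure_pmf.prob (averaging_chain n x0 (cutoff_time a n))
              {x. L1_dev n x > 2 * std_normal_cdf (- a) + \<epsilon>}) \<longlonglongrightarrow> 0"
proof -
  define L where "L n = log 2 (real n)" for n :: nat
  \<comment> \<open>Half of \<open>\<epsilon>\<close> pays for \<open>3 * \<eta>\<close>; the other
    half for twice a tail error of \<open>\<epsilon> / 4\<close>, itself
    \<open>\<epsilon> / 8\<close> from continuity and \<open>\<epsilon> / 8\<close> from the limit
    theorem.\<close>
  define \<eta> where "\<eta> = \<epsilon> / 6"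
  have \<eta>: "0 < \<eta>" using assms by (simp add: \<eta>_def)
  \<comment> \<open>Reserving the last \<open>r\<close> steps for flattening lowers the mean halving
    count by 2r/n, at most two units of \<open>\<delta> * sqrt (L n)\<close>; the third unit covers
    the rounding error 2/n.\<close>
  obtain \<delta> where \<delta>: "0 < \<delta>" "std_normal_cdf (- a + 3 * \<delta>) < std_normal_cdf (- a) + \<epsilon> / 8"
  proof -
    have "((\<lambda>\<delta>. std_normal_cdf (- a + 3 * \<delta>)) \<longlongrightarrow> std_normal_cdf (- a + 3 * 0)) (at_right 0)"
      by (intro isCont_tendsto_compose[OF isCont_std_normal_cdf] tendsto_intros)
    then have "\<forall>\<^sub>F \<delta> in at_right 0. std_normal_cdf (- a + 3 * \<delta>) < std_normal_cdf (- a) + \<epsilon> / 8"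
      using assms by (intro order_tendstoD) auto
    moreover have "\<forall>\<^sub>F \<delta> in at_right 0. (0::real) < \<delta>"
      by (rule eventually_at_right_less)
    ultimately have "\<forall>\<^sub>F \<delta> in at_right 0. 0 < \<delta> \<and> std_normal_cdf (- a + 3 * \<delta>) < std_normal_cdf (- a) + \<epsilon> / 8"
      by eventually_elim simp
    from eventually_happens[OF this] show ?thesis using that by auto
  qed
  \<comment> \<open>One scale serves as ramp width and, through \<open>r\<close>, as flattening
    time. It tends to infinity, yet is only about \<open>\<delta>\<close> standard deviations, the
    halving count having variance asymptotic to \<open>L n\<close>.\<close>
  define w where "w n = \<delta> * sqrt (L n)" for n
  define r where "r n = nat \<lfloor>real n * w n\<rfloor>" for n
  define K where "K n = cutoff_time a n - r n" for n
  \<comment> \<open>\<open>max 2 n\<close> keeps the success probability in \<open>[0, 1]\<close> for every \<open>n\<close>.\<close>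
  let ?mean = "\<lambda>n. real (K n) * (2 / real (max 2 n))"
  have sqrtL: "filterlim (\<lambda>n. sqrt (L n)) at_top sequentially"
    unfolding L_def by real_asymp
  have ev: "\<forall>\<^sub>F n in sequentially. 2 \<le> n \<and> 0 < L n \<and> 0 < w n \<and> 2 / real n \<le> w n
      \<and> real n * w n \<le> real n * (L n + a * sqrt (L n)) / 2 - 1"
  proof (intro eventually_conj)
    show "\<forall>\<^sub>F n in sequentially. 0 < L n" unfolding L_def by real_asymp
    show "\<forall>\<^sub>F n in sequentially. 0 < w n" using \<delta>(1) unfolding w_def L_def by real_asymp
    show "\<forall>\<^sub>F n in sequentially. 2 / real n \<le> w n" using \<delta>(1) unfolding w_def L_def by real_asymp
    show "\<forall>\<^sub>F n in sequentially. real n * w n \<le> real n * (L n + a * sqrt (L n)) / 2 - 1"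
      unfolding w_def L_def by real_asymp
  qed (rule eventually_ge_at_top)
  have facts: "\<forall>\<^sub>F n in sequentially. 2 \<le> n \<and> 0 < w n \<and> cutoff_time a n = K n + r n
      \<and> real n * w n - 1 \<le> r n \<and> 2 * K n \<le> n * (L n + a * sqrt (L n))
      \<and> L n + (a - 3 * \<delta>) * sqrt (L n) \<le> 2 * K n / n"
    using ev
  proof eventually_elim
    case (elim n)
    define t where "t = real n * (L n + a * sqrt (L n)) / 2"
    have t: "cutoff_time a n = nat \<lfloor>t\<rfloor>" by (simp add: cutoff_time_def t_def L_def)
    \<comment> \<open>As \<open>t\<close> exceeds \<open>real n * w n + 1\<close>,
      \<open>nat\<close> does not truncate in \<open>cutoff_time\<close>, and \<open>r n\<close> is
      at most the cutoff time, so the subtraction defining \<open>K n\<close> is genuine.\<close>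
    have nw: "0 < real n * w n" "real n * w n \<le> t - 1" using elim by (simp_all add: t_def)
    have T: "real (cutoff_time a n) \<le> t" "t - 1 \<le> real (cutoff_time a n)"
      unfolding t using nw by linarith+
    have R: "real (r n) \<le> real n * w n" "real n * w n - 1 \<le> real (r n)"
      unfolding r_def using nw by linarith+
    have "r n \<le> cutoff_time a n" using T R nw by linarith
    then have sum: "cutoff_time a n = K n + r n" and K: "real (K n) = real (cutoff_time a n) - real (r n)"
      by (simp_all add: K_def of_nat_diff)
    have "2 * K n \<le> n * (L n + a * sqrt (L n))" using K T(1) by (simp add: t_def)
    moreover have "(n * (L n + a * sqrt (L n)) - 2 - 2 * (real n * w n)) / n \<le> 2 * K n / n"
      using K T(2) R(1) by (intro divide_right_mono) (auto simp: t_def)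
    then have "L n + a * sqrt (L n) - 2 / n - 2 * w n \<le> 2 * K n / n"
      using elim by (simp add: diff_divide_distrib)
    then have "L n + (a - 3 * \<delta>) * sqrt (L n) \<le> 2 * K n / n"
      using elim by (simp add: w_def algebra_simps)
    ultimately show ?case using elim sum R by simp
  qed
  have clt: "(\<lambda>n. measure_pmf.prob (binomial_pmf (K n) (2 / real (max 2 n)))
      {b. (real b - ?mean n) / sqrt (L n) \<le> - a + 3 * \<delta>}) \<longlonglongrightarrow> std_normal_cdf (- a + 3 * \<delta>)"
  proof (rule binomial_tendsto_std_normal[OF _ _ sqrtL])
    show "2 / real (max 2 n) \<in> {0..1}" for n by auto
    have "(\<lambda>n. 2 / real n) \<longlonglongrightarrow> 0" by real_asymp
    then show "(\<lambda>n. 2 / real (max 2 n)) \<longlonglongrightarrow> 0"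
      by (rule Lim_transform_eventually) (auto intro: eventually_mono[OF eventually_ge_at_top[of 2]] simp: max_def)
    \<comment> \<open>The mean differs from \<open>L n\<close> by a term of order
      \<open>sqrt (L n)\<close>, so the ratio is 1 up to order
      \<open>1 / sqrt (L n)\<close>.\<close>
    show "(\<lambda>n. ?mean n / (sqrt (L n))\<^sup>2) \<longlonglongrightarrow> 1"
    proof (rule tendsto_sandwich)
      have bounds: "\<forall>\<^sub>F n in sequentially. 1 + (a - 3 * \<delta>) / sqrt (L n) \<le> ?mean n / (sqrt (L n))\<^sup>2
          \<and> ?mean n / (sqrt (L n))\<^sup>2 \<le> 1 + a / sqrt (L n)"
        using facts ev
      proof eventually_elim
        case (elim n)
        then have m: "?mean n = 2 * K n / n" "real n > 0" by (simp_all add: max_def)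
        define s where "s = sqrt (L n)"
        have s: "0 < s" "L n = s * s" using elim by (simp_all add: s_def)
        have "s * s + (a - 3 * \<delta>) * s \<le> ?mean n" "?mean n \<le> s * s + a * s"
          unfolding m(1) using elim m(2) s by (simp_all add: s_def[symmetric] field_simps)
        then have "(s * s + (a - 3 * \<delta>) * s) / s\<^sup>2 \<le> ?mean n / s\<^sup>2"
          "?mean n / s\<^sup>2 \<le> (s * s + a * s) / s\<^sup>2"
          by (blast intro: divide_right_mono zero_le_power2)+
        moreover have "(s * s + b * s) / s\<^sup>2 = 1 + b / s" for b
          using s(1) by (simp add: add_divide_distrib power2_eq_square)
        ultimately show ?case
          by (simp only: s_def[symmetric] simp_thms)
      qed
      show "\<forall>\<^sub>F n in sequentially. 1 + (a - 3 * \<delta>) / sqrt (L n) \<le> ?mean n / (sqrt (L n))\<^sup>2"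
        "\<forall>\<^sub>F n in sequentially. ?mean n / (sqrt (L n))\<^sup>2 \<le> 1 + a / sqrt (L n)"
        using bounds by (auto elim: eventually_mono)
      show "(\<lambda>n. 1 + (a - 3 * \<delta>) / sqrt (L n)) \<longlonglongrightarrow> 1" "(\<lambda>n. 1 + a / sqrt (L n)) \<longlonglongrightarrow> 1"
        unfolding L_def by real_asymp+
    qed
  qed
  have small: "\<forall>\<^sub>F n in sequentially. measure_pmf.prob (binomial_pmf (K n) (2 / real (max 2 n)))
      {b. (real b - ?mean n) / sqrt (L n) \<le> - a + 3 * \<delta>} < std_normal_cdf (- a + 3 * \<delta>) + \<epsilon> / 8"
    using clt assms by (intro order_tendstoD) auto
  \<comment> \<open>A bound free of \<open>x0\<close>: \<open>K n\<close> is replaced by its upper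
    estimate and the flattening term by that of \<open>flattening_error_le\<close>.\<close>
  define B where "B n = (2 * (1 / w n)\<^sup>2 * (1 + (L n + a * sqrt (L n)) / (2 * (real n - 1)))
      + exp (1 - w n) * (2 powr w n + 2)) / \<eta>\<^sup>2" for n
  let ?P = "\<lambda>n x0. measure_pmf.prob (averaging_chain n x0 (cutoff_time a n))
              {x. L1_dev n x > 2 * std_normal_cdf (- a) + \<epsilon>}"
  have upper: "\<forall>\<^sub>F n in sequentially. (SUP x0 \<in> prob_vectors n. ?P n x0) \<le> B n"
    using facts small ev
  proof eventually_elim
    case (elim n)
    then have n: "2 \<le> n" "real n \<ge> 2" and s: "0 < sqrt (L n)" by auto
    \<comment> \<open>By the lower estimate of the mean, the level \<open>L n\<close> standardises
      to at most \<open>- a + 3 * \<delta>\<close>.\<close>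
    have "{b. real b \<le> L n} \<subseteq> {b. (real b - ?mean n) / sqrt (L n) \<le> - a + 3 * \<delta>}"
    proof safe
      fix b assume "real b \<le> L n"
      also have "L n \<le> ?mean n + (- a + 3 * \<delta>) * sqrt (L n)"
        using elim by (simp add: max_def algebra_simps)
      finally show "(real b - ?mean n) / sqrt (L n) \<le> - a + 3 * \<delta>"
        using s by (simp add: pos_divide_le_eq)
    qed
    then have "measure_pmf.prob (binomial_pmf (K n) (2 / n)) {b. real b \<le> L n}
      \<le> measure_pmf.prob (binomial_pmf (K n) (2 / real (max 2 n)))
          {b. (real b - ?mean n) / sqrt (L n) \<le> - a + 3 * \<delta>}"
      using n by (simp only: max_absorb2) (intro measure_pmf.finite_measure_mono, auto)
    also have "\<dots> < std_normal_cdf (- a) + \<epsilon> / 4" using elim \<delta>(2) by linarith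
    finally have tail: "2 * measure_pmf.prob (binomial_pmf (K n) (2 / n)) {b. real b \<le> L n} + 3 * \<eta>
        \<le> 2 * std_normal_cdf (- a) + \<epsilon>"
      by (simp add: \<eta>_def)
    show ?case
    proof (rule cSUP_least)
      show "prob_vectors n \<noteq> {}" using n by (intro prob_vectors_nonempty) simp
      fix x0 assume x0: "x0 \<in> prob_vectors n"
      have "?P n x0 \<le> (2 * (1 / w n)\<^sup>2 * (1 + K n / (n * (real n - 1)))
        + n * (1 - 1 / n) ^ r n * (2 powr w n / n + 1 / (real n - 1))) / \<eta>\<^sup>2"
        using prob_L1_dev_tail_le[OF n(1) x0 _ L_def \<eta> tail, of "w n" "r n"] elim by simp
      also have "\<dots> \<le> B n"
        unfolding B_def
      proof (intro divide_right_mono add_mono mult_left_mono flattening_error_le n order_refl)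
        have "K n / (n * (real n - 1)) = (2 * K n) / (2 * (n * (real n - 1)))"
          using mult_divide_mult_cancel_left[of 2 "real (K n)" "n * (real n - 1)"] by simp
        also have "\<dots> \<le> n * (L n + a * sqrt (L n)) / (2 * (n * (real n - 1)))"
          using elim n by (intro divide_right_mono) auto
        finally show "K n / (n * (real n - 1)) \<le> (L n + a * sqrt (L n)) / (2 * (real n - 1))"
          using n by (simp only: mult.left_commute[of 2]) simp
      qed (use elim in auto)
      finally show "?P n x0 \<le> B n" .
    qed
  qed
  \<comment> \<open>A real supremum dominates its members only over a bounded set; here 1 bounds all
    probabilities.\<close>
  have lower: "\<forall>\<^sub>F n in sequentially. 0 \<le> (SUP x0 \<in> prob_vectors n. ?P n x0)"
    using eventually_ge_at_top[of 1]
  proof eventually_elim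
    case (elim n)
    then obtain x0 where "x0 \<in> prob_vectors n" using prob_vectors_nonempty by blast
    then show ?case
      by (intro cSUP_upper2[of _ _ x0]) (auto intro!: bdd_aboveI[of _ 1])
  qed
  have "B \<longlonglongrightarrow> 0"
  proof -
    have w: "filterlim w at_top sequentially"
      using \<delta>(1) unfolding w_def[abs_def] L_def by real_asymp
    \<comment> \<open>This makes the exponent of exp (- v) times \<open>2 powr v\<close> negative,
      so flattening outweighs the ramp.\<close>
    have "ln 2 < (1::real)" using ln_2_less_1 by simp
    then have "((\<lambda>v::real. exp (1 + (ln 2 - 1) * v) + 2 * exp (1 - v)) \<longlongrightarrow> 0) at_top"
      by real_asymp
    also have "(\<lambda>v::real. exp (1 + (ln 2 - 1) * v) + 2 * exp (1 - v)) = (\<lambda>v. exp (1 - v) * (2 powr v + 2))"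
      by (simp add: fun_eq_iff powr_def distrib_left exp_add[symmetric] algebra_simps)
    finally have 1: "(\<lambda>n. exp (1 - w n) * (2 powr w n + 2)) \<longlonglongrightarrow> 0"
      by (rule filterlim_compose[OF _ w])
    have 2: "(\<lambda>n. 1 / w n) \<longlonglongrightarrow> 0"
      by (intro tendsto_divide_0[OF tendsto_const] filterlim_at_top_imp_at_infinity w)
    have 3: "(\<lambda>n. 1 + (L n + a * sqrt (L n)) / (2 * (real n - 1))) \<longlonglongrightarrow> 1"
      unfolding L_def by real_asymp
    have "B \<longlonglongrightarrow> (2 * 0\<^sup>2 * 1 + 0) / \<eta>\<^sup>2"
      unfolding B_def[abs_def] by (intro tendsto_intros 1 2 3) (use \<eta> in simp)
    then show ?thesis by simp
  qed
  then show ?thesis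
    by (rule tendsto_sandwich[OF lower upper tendsto_const])
qed

end
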